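(* Consider the DC microgrid, the ZTS attacks with constant fake unknown inputs on a set $\tilde{\mathcal E}_c$ of communication links, the dynamic average consensus (DAC) estimators, the sliding-time-window detection indicator $\mathcal d_i(t)$ with window length $T>0$, and the detection threshold $\bar{\mathcal d}_i$ described in the context. If $$\langle\boldsymbol\psi_a(\infty)\rangle>\frac1T\,\bar{\mathcal d}_i ,$$ then the attacks are detected by the indicator in DGU $i$, i.e. the condition $\mathcal d_i(t)\le\bar{\mathcal d}_i$ for all $t\ge t_s$ is violated.
   Context: Notation: $\langle\boldsymbol v\rangle$ is the average of the entries of $\boldsymbol v\in\mathbb R^N$; $y(\infty)=\lim_{t\to\infty}y(t)$. Here $\langle\boldsymbol\psi_a(\infty)\rangle=\lim_{t\to\infty}\langle\boldsymbol\psi_a(t)\rangle$, with the value $+\infty$ allowed (ramp growth). Network: $N$ DGUs with node set $\mathcal V=\{1,\dots,N\}$. The electrical and communication networks are connected weighted undirected graphs with the same topology and the same positive edge weights $a^c_{ij}=a^c_{ji}$, so their Laplacians coincide, $L=M$. $\mathcal N_i^c$ is the set of neighbours of $i$. All nominal reference voltages equal $V_{ref}$. Rated currents $I^s_{ti}>0$, gain $k_I>0$, constant load currents $\boldsymbol i_l\in\mathbb R^N$. Dynamics: with PCC voltages $\boldsymbol v=[V_1,\dots,V_N]^{\rm T}$, output currents $\boldsymbol i_t=[I_{t1},\dots,I_{tN}]^{\rm T}$ and secondary inputs $\boldsymbol\psi$: $\boldsymbol v(t)=V_{ref}\mathbb 1+\boldsymbol\psi(t)$ (primary loops simplified to unit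 gains), $\boldsymbol i_t(t)=M\boldsymbol v(t)+\boldsymbol i_l$, and $$\dot\psi_i=-k_I\sum_{j\in\mathcal N_i^c}a^c_{ij}\Big(\frac{I_{ti}}{I^s_{ti}}-\frac{I^c_{i,j}}{I^s_{tj}}\Big),$$ where $I^c_{i,j}$ is the current of DGU $j$ as received by DGU $i$ ($=I_{tj}$ if the link is not attacked). Without attack voltage balancing $\langle\boldsymbol v(\infty)\rangle=V_{ref}$ holds; accordingly $\langle\boldsymbol\psi(0)\rangle=0$. Attacks: for $(i,j)\in\tilde{\mathcal E}_c$ and $t\ge T_a$, $I^c_{i,j}=I_{tj}+\boldsymbol k^{\rm T}\boldsymbol\phi_{i,j}$, $\boldsymbol k^{\rm T}=[0,1,0]$, where $\dot{\boldsymbol\phi}_{i,j}=A_{kj}\boldsymbol\phi_{i,j}+\bar E_j\bar{\boldsymbol d}^a_{ij}$, $\boldsymbol\phi_{i,j}(T_a)=\mathbf 0$, with constant $\bar{\boldsymbol d}^a_{ij}\in\mathbb R^2$, $\bar E_j\bar{\boldsymbol d}^a_{ij}\neq\mathbf 0$; $A_{kj}\in\mathbb R^{3\times3}$ is Hurwitz and $\bar E_j=\begin{bmatrix}1/C_{tj}&0\\0&0\\0&1\end{bmatrix}$, $C_{tj}>0$. Write $\boldsymbol\psi=\tilde{\boldsymbol\psi}+\boldsymbol\psi_a$ with $\tilde{\boldsymbol\psi}$ the attack-free solution (same initial condition) and $\boldsymbol\psi_a$ the component due to the attacks. DAC estimators: each DGU $i$ runs $$\dot{\boldsymbol X}_{i1}=A_1\boldsymbol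 X_{i1}+B_1\Big(V_i-\gamma\sum_{j\in\mathcal N_i^c}a^{cd}_{ij}(\eta_i-\eta_j)\Big),\quad \widehat V_i=C_1\boldsymbol X_{i1},$$ $$\dot{\boldsymbol X}_{i2}=A_2\boldsymbol X_{i2}+B_2\,\gamma\sum_{j\in\mathcal N_i^c}a^{cd}_{ij}(\widehat V_i-\widehat V_j),\quad \eta_i=C_2\boldsymbol X_{i2},$$ with $\gamma>0$, symmetric weights $a^{cd}_{ij}=a^{cd}_{ji}>0$ on the communication links, arbitrary initial states, and, for some $a>0$, $$A_1=\begin{bmatrix}-2a&-a^2\\1&0\end{bmatrix},\ B_1=\begin{bmatrix}1\\0\end{bmatrix},\ C_1=[2a\ \ a^2],\quad A_2=\begin{bmatrix}0&0\\1&0\end{bmatrix},\ B_2=\begin{bmatrix}1\\0\end{bmatrix},\ C_2=[1\ \ a].$$ The DAC parameters are hidden from the attacker, so the data exchanged between DAC estimators are uncorrupted (as already written above). Detection: $\widehat V_i^{err}(t)=V_{ref}-\widehat V_i(t)$. With activation time $t_s>0$, $\mathcal d_i(t)=0$ for $t_s\le t<t_s+T$ and $\mathcal d_i(t)=\int_{t-T}^t|\widehat V_i^{err}(\tau)|\,d\tau$ for $t\ge t_s+T$. The threshold is a constant $\bar{\mathcal d}_i\ge0$, $\bar{\mathcal d}_i=\max\int_{t-T}^t|\widehat V^{err}_{i|o}(\tau)|d\tau$, the maximum being over $t\ge t_s+T$ and over a finite set of tolerated daily operations $o$ occurring at time $t_s$, where $\widehat V^{err}_{i|o}$ is the value of $\widehat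 V^{err}_i$ under operation $o$ in the absence of attack; for the statement it may be regarded as a given constant. *)

theory Defs
  imports "HOL-Analysis.Analysis"
begin

text \<open>
  The nodes are the elements of a finite type \<open>'n\<close>, so that $N$ is \<open>CARD('n)\<close>, vectors in
  $R^N$ are of type \<open>real ^ 'n\<close>, and the neighbours of \<open>i\<close> in the graph with edge relation \<open>E\<close>
  are \<open>E `` {i}\<close>.  Edge weights \<open>w i j\<close> are only relevant for \<open>(i, j) \<in> E\<close>.  The dynamics start
  at time \<open>0\<close>; derivatives at the initial time are one-sided.
\<close>

definition average :: "real ^ 'n \<Rightarrow> real" where
  "average v = (\<Sum>i\<in>UNIV. v $ i) / real CARD('n)"

definition connected_graph :: "('n \<times> 'n) set \<Rightarrow> bool" where
  "connected_graph E \<longleftrightarrow> sym E \<and> irrefl E \<and> E\<^sup>* = UNIV"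

definition edge_weights :: "('n \<times> 'n) set \<Rightarrow> ('n \<Rightarrow> 'n \<Rightarrow> real) \<Rightarrow> bool" where
  "edge_weights E w \<longleftrightarrow> (\<forall>(i, j)\<in>E. w i j > 0 \<and> w i j = w j i)"

definition laplacian :: "('n::finite \<times> 'n) set \<Rightarrow> ('n \<Rightarrow> 'n \<Rightarrow> real) \<Rightarrow> real ^ 'n ^ 'n" where
  "laplacian E w = (\<chi> i j. if i = j then \<Sum>k\<in>E `` {i}. w i k
                           else if (i, j) \<in> E then - w i j else 0)"

definition hurwitz :: "real ^ 'm ^ 'm \<Rightarrow> bool" where
  "hurwitz A \<longleftrightarrow>
     (\<forall>z::complex. (\<exists>x. x \<noteq> 0 \<and> map_matrix complex_of_real A *v x = z *s x) \<longrightarrow> Re z < 0)"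

subsection \<open>Microgrid with secondary control\<close>

definition voltages :: "real \<Rightarrow> real ^ 'n \<Rightarrow> real ^ 'n" where
  "voltages Vref \<psi> = (\<chi> i. Vref) + \<psi>"

text \<open>
  The electrical and the communication network share the edges \<open>E\<close> and the weights \<open>w\<close>, so the
  Laplacian below is that of both.
\<close>

definition output_currents ::
  "('n::finite \<times> 'n) set \<Rightarrow> ('n \<Rightarrow> 'n \<Rightarrow> real) \<Rightarrow> real ^ 'n \<Rightarrow> real ^ 'n \<Rightarrow> real ^ 'n" where
  "output_currents E w il v = laplacian E w *v v + il"

text \<open>
  \<open>\<delta> i j t\<close> is the falsification of the current of DGU \<open>j\<close> as received by DGU \<open>i\<close> at time \<open>t\<close>,
  i.e. the received current minus the true one; \<open>\<delta> = (\<lambda>_ _ _. 0)\<close> is the attack-free case.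
\<close>

definition secondary_solution ::
  "('n::finite \<times> 'n) set \<Rightarrow> ('n \<Rightarrow> 'n \<Rightarrow> real) \<Rightarrow> real \<Rightarrow> ('n \<Rightarrow> real) \<Rightarrow> real \<Rightarrow> real ^ 'n \<Rightarrow>
    ('n \<Rightarrow> 'n \<Rightarrow> real \<Rightarrow> real) \<Rightarrow> (real \<Rightarrow> real ^ 'n) \<Rightarrow> bool" where
  "secondary_solution E w kI Is Vref il \<delta> \<psi> \<longleftrightarrow>
     (\<forall>t\<ge>0. (\<psi> has_vector_derivative
        (let It = output_currents E w il (voltages Vref (\<psi> t)) in
         \<chi> i. - kI * (\<Sum>j\<in>E `` {i}. w i j * (It $ i / Is i - (It $ j + \<delta> i j t) / Is j))))
        (at t within {0..}))"

subsection \<open>Attacks\<close>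

definition E_bar :: "real \<Rightarrow> real ^ 2 ^ 3" where
  "E_bar Ct = vector [vector [1 / Ct, 0], vector [0, 0], vector [0, 1]]"

definition k_vec :: "real ^ 3" where
  "k_vec = vector [0, 1, 0]"

definition attack_state ::
  "real \<Rightarrow> real ^ 3 ^ 3 \<Rightarrow> real \<Rightarrow> real ^ 2 \<Rightarrow> (real \<Rightarrow> real ^ 3) \<Rightarrow> bool" where
  "attack_state Ta Ak Ct d \<phi> \<longleftrightarrow>
     \<phi> Ta = 0 \<and>
     (\<forall>t\<ge>Ta. (\<phi> has_vector_derivative (Ak *v \<phi> t + E_bar Ct *v d)) (at t within {Ta..}))"

definition falsification ::
  "('n \<times> 'n) set \<Rightarrow> real \<Rightarrow> ('n \<Rightarrow> 'n \<Rightarrow> real \<Rightarrow> real ^ 3) \<Rightarrow> 'n \<Rightarrow> 'n \<Rightarrow> real \<Rightarrow> real" where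
  "falsification Ea Ta \<phi> i j t = (if (i, j) \<in> Ea \<and> t \<ge> Ta then k_vec \<bullet> \<phi> i j t else 0)"

subsection \<open>Dynamic average consensus estimators\<close>

definition A1 :: "real \<Rightarrow> real ^ 2 ^ 2" where
  "A1 a = vector [vector [- 2 * a, - a\<^sup>2], vector [1, 0]]"

definition B1 :: "real ^ 2" where
  "B1 = vector [1, 0]"

definition C1 :: "real \<Rightarrow> real ^ 2" where
  "C1 a = vector [2 * a, a\<^sup>2]"

definition A2 :: "real ^ 2 ^ 2" where
  "A2 = vector [vector [0, 0], vector [1, 0]]"

definition B2 :: "real ^ 2" where
  "B2 = vector [1, 0]"

definition C2 :: "real \<Rightarrow> real ^ 2" where
  "C2 a = vector [1, a]"

definition dac_solution ::
  "('n::finite \<times> 'n) set \<Rightarrow> ('n \<Rightarrow> 'n \<Rightarrow> real) \<Rightarrow> real \<Rightarrow> real \<Rightarrow> (real \<Rightarrow> real ^ 'n) \<Rightarrow>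
    ('n \<Rightarrow> real \<Rightarrow> real ^ 2) \<Rightarrow> ('n \<Rightarrow> real \<Rightarrow> real ^ 2) \<Rightarrow> bool" where
  "dac_solution E wd \<gamma> a v X1 X2 \<longleftrightarrow>
     (\<forall>i. \<forall>t\<ge>0.
        (X1 i has_vector_derivative
           A1 a *v X1 i t
           + (v t $ i - \<gamma> * (\<Sum>j\<in>E `` {i}. wd i j * (C2 a \<bullet> X2 i t - C2 a \<bullet> X2 j t))) *\<^sub>R B1)
          (at t within {0..}) \<and>
        (X2 i has_vector_derivative
           A2 *v X2 i t
           + (\<gamma> * (\<Sum>j\<in>E `` {i}. wd i j * (C1 a \<bullet> X1 i t - C1 a \<bullet> X1 j t))) *\<^sub>R B2)
          (at t within {0..}))"

subsection \<open>Detection indicator\<close>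

text \<open>
  \<open>err\<close> is the estimation error signal $V_{ref} - \hat V_i$.  The indicator is only meant for
  \<open>t \<ge> ts\<close>.
\<close>

definition detection_indicator :: "real \<Rightarrow> real \<Rightarrow> (real \<Rightarrow> real) \<Rightarrow> real \<Rightarrow> real" where
  "detection_indicator ts T err t =
     (if t < ts + T then 0 else integral {t - T..t} (\<lambda>\<tau>. \<bar>err \<tau>\<bar>))"

end

theory Submission
  imports Defs "HOL-Computational_Algebra.Fundamental_Theorem_Algebra"
begin

text \<open>
  Averaging the secondary dynamics over the nodes cancels all Laplacian terms, so the mean of \<open>\<psi>\<close>
  is driven by the false data alone.  Each attack state solves a Hurwitz system with constant input,
  hence the mean is a ramp plus a convergent term, and its limit exists in the extended reals.
  The deviation of \<open>\<psi>\<close> from its mean satisfies a stable equation with convergent input and thus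
  converges.  In the estimators the double integrator is an internal model of constants and ramps:
  after subtracting the mean voltage and projecting the integrator states by the Laplacian, a
  stable system with convergent input remains, whose equilibrium shows that each estimate tracks
  the mean voltage with vanishing error.  So the error of DGU \<open>i\<close> is eventually larger in absolute
  value than a constant exceeding the threshold divided by \<open>T\<close>, and one window of length \<open>T\<close>
  beyond that time violates the threshold.
\<close>

section \<open>Stable linear systems\<close>

text \<open>The two equations are the real and imaginary parts of the eigenvalue equation for the
  vector \<open>x + \<i> y\<close> and the eigenvalue \<open>\<alpha> + \<i> \<beta>\<close>, so all
  eigenvalues of the complexification have negative real part. The real form applies to any
  Euclidean space, including the product space of the estimator states.\<close>

definition stable_map :: "('b::euclidean_space \<Rightarrow> 'b) \<Rightarrow> bool" where
  "stable_map f \<longleftrightarrow> linear f \<and>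
     (\<forall>x y \<alpha> \<beta>. f x = \<alpha> *\<^sub>R x - \<beta> *\<^sub>R y \<longrightarrow> f y = \<beta> *\<^sub>R x + \<alpha> *\<^sub>R y \<longrightarrow> \<alpha> \<ge> 0 \<longrightarrow> x = 0 \<and> y = 0)"

section \<open>Decay of scalar energies and of a scalar complex equation\<close>

lemma nonincreasing_on_ray:
  fixes h :: "real \<Rightarrow> real"
  assumes deriv: "\<And>t. t \<ge> t0 \<Longrightarrow> (h has_real_derivative h' t) (at t within {t0..})"
    and nonpos: "\<And>t. t \<ge> t1 \<Longrightarrow> h' t \<le> 0"
    and "t0 \<le> t1" "t1 \<le> t"
  shows "h t \<le> h t1"
proof (cases "t1 = t")
  case False
  with assms have "t1 < t" by simp
  moreover have "(h has_derivative (*) (h' s)) (at s within {t1..t})" if "t1 \<le> s" "s \<le> t" for s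
    using has_field_derivative_subset[OF deriv[of s], of "{t1..t}"] assms that
    by (auto simp: has_field_derivative_def)
  ultimately obtain s where s: "s \<in> {t1<..<t}" "h t - h t1 = h' s * (t - t1)"
    using mvt_simple[of t1 t h "\<lambda>s. (*) (h' s)"] by auto
  then have "h' s * (t - t1) \<le> 0"
    using nonpos[of s] by (intro mult_nonpos_nonneg) auto
  with s show ?thesis by simp
qed simp

text \<open>Gronwall argument: once \<open>g < c * \<epsilon>\<close>, the function
  \<open>exp (c * t) * (e t - \<epsilon>)\<close> is nonincreasing. Hence
  \<open>e - \<epsilon>\<close> lies below a decaying exponential, and \<open>e\<close> is
  eventually below \<open>2 * \<epsilon>\<close>.\<close>

lemma decaying_energy_tendsto_0:
  fixes e :: "real \<Rightarrow> real"
  assumes deriv: "\<And>t. t \<ge> t0 \<Longrightarrow> (e has_real_derivative e' t) (at t within {t0..})"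
    and bound: "\<And>t. t \<ge> t0 \<Longrightarrow> e' t \<le> - c * e t + g t"
    and nonneg: "\<And>t. e t \<ge> 0" and "c > 0" and g: "(g \<longlongrightarrow> 0) at_top"
  shows "(e \<longlongrightarrow> 0) at_top"
proof (rule order_tendstoI)
  fix \<epsilon>' :: real assume "0 < \<epsilon>'"
  define \<epsilon> where "\<epsilon> = \<epsilon>' / 2"
  have "\<epsilon> > 0" using \<open>0 < \<epsilon>'\<close> by (simp add: \<epsilon>_def)
  then have "eventually (\<lambda>t. g t < c * \<epsilon>) at_top"
    using order_tendstoD(2)[OF g, of "c * \<epsilon>"] \<open>c > 0\<close> by simp
  then obtain t2 where t2: "\<And>t. t \<ge> t2 \<Longrightarrow> g t < c * \<epsilon>"
    by (auto simp: eventually_at_top_linorder)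
  define t1 where "t1 = max t0 t2"
  define h where "h = (\<lambda>t. exp (c * t) * (e t - \<epsilon>))"
  have h: "(h has_real_derivative exp (c * t) * (c * (e t - \<epsilon>) + e' t)) (at t within {t0..})"
    if "t \<ge> t0" for t
    unfolding h_def
    by (rule derivative_eq_intros deriv that refl | simp add: algebra_simps)+
  have h_le: "h t \<le> h t1" if "t \<ge> t1" for t
  proof (rule nonincreasing_on_ray[OF h])
    fix s assume "t1 \<le> s"
    then have "c * (e s - \<epsilon>) + e' s \<le> 0"
      using bound[of s] t2[of s] by (simp add: t1_def algebra_simps)
    then show "exp (c * s) * (c * (e s - \<epsilon>) + e' s) \<le> 0"
      by (intro mult_nonneg_nonpos) auto
  qed (use that in \<open>auto simp: t1_def\<close>)
  have "filterlim (\<lambda>t. c * t) at_top at_top"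
    using \<open>c > 0\<close> by (intro filterlim_tendsto_pos_mult_at_top[OF tendsto_const] filterlim_ident)
  then have "((\<lambda>t. exp (- (c * t))) \<longlongrightarrow> 0) at_top"
    using filterlim_compose[OF exp_at_bot] filterlim_uminus_at_top by blast
  then have "((\<lambda>t. exp (- (c * t)) * h t1) \<longlongrightarrow> 0) at_top"
    by (rule tendsto_mult_left_zero)
  then have "eventually (\<lambda>t. exp (- (c * t)) * h t1 < \<epsilon>) at_top"
    using \<open>\<epsilon> > 0\<close> by (rule order_tendstoD)
  then show "eventually (\<lambda>t. e t < \<epsilon>') at_top"
    using eventually_ge_at_top[of t1]
  proof eventually_elim
    case (elim t)
    have "e t - \<epsilon> = exp (- (c * t)) * h t"
      by (simp add: h_def exp_minus)
    also have "\<dots> \<le> exp (- (c * t)) * h t1"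
      using h_le elim by simp
    also have "\<dots> < \<epsilon>" by (fact elim)
    finally show ?case by (simp add: \<epsilon>_def)
  qed
qed (use nonneg in \<open>auto intro: always_eventually less_le_trans\<close>)

text \<open>
  A pair \<open>(x, y)\<close> stands for the vector \<open>x + \<i> y\<close> of the complexification.
\<close>

definition cscale :: "complex \<Rightarrow> 'b::real_vector \<times> 'b \<Rightarrow> 'b \<times> 'b" where
  "cscale z v = (Re z *\<^sub>R fst v - Im z *\<^sub>R snd v, Im z *\<^sub>R fst v + Re z *\<^sub>R snd v)"

lemma linear_cscale: "linear (cscale z)"
  by (rule linearI) (auto simp: cscale_def algebra_simps)

lemma cscale_add_left: "cscale (z + w) v = cscale z v + cscale w v"
  and cscale_cscale: "cscale z (cscale w v) = cscale (z * w) v"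
  and cscale_of_real: "cscale (complex_of_real r) v = r *\<^sub>R v"
  and cscale_zero_left [simp]: "cscale 0 v = 0"
  and cscale_one [simp]: "cscale 1 v = v"
  by (auto simp: cscale_def algebra_simps prod_eq_iff)

lemma cscale_eq_0D: "cscale z v = 0 \<Longrightarrow> z \<noteq> 0 \<Longrightarrow> v = 0"
  using cscale_cscale[of "inverse z" z v] by (simp add: linear_0[OF linear_cscale])

text \<open>The imaginary part of \<open>z\<close> acts as a skew-symmetric map and drops out of the
  quadratic form.\<close>

lemma inner_cscale: "inner v (cscale z v) = Re z * inner v v"
  by (cases v) (simp add: cscale_def inner_Pair algebra_simps inner_commute)

text \<open>The squared norm of \<open>y\<close> decays at rate \<open>2 * c\<close> with
  \<open>c = - Re z\<close>, up to the cross term with \<open>w\<close>. Young's inequality spends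
  half of this rate on the cross term and leaves the vanishing forcing
  \<open>(norm (w t))\<^sup>2 / c\<close>.\<close>

lemma cscale_forced_tendsto_0:
  fixes y :: "real \<Rightarrow> 'b::euclidean_space \<times> 'b"
  assumes deriv: "\<And>t. t \<ge> t0 \<Longrightarrow> (y has_vector_derivative cscale z (y t) + w t) (at t within {t0..})"
    and z: "Re z < 0" and w: "(w \<longlongrightarrow> 0) at_top"
  shows "(y \<longlongrightarrow> 0) at_top"
proof -
  define c where "c = - Re z"
  have "c > 0" using z by (simp add: c_def)
  have "((\<lambda>t. inner (y t) (y t)) \<longlongrightarrow> 0) at_top"
  proof (rule decaying_energy_tendsto_0[where ?t0.0 = t0 and c = c
        and g = "\<lambda>t. (norm (w t))\<^sup>2 / c"
        and e' = "\<lambda>t. 2 * inner (y t) (cscale z (y t) + w t)"])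
    fix t assume "t \<ge> t0"
    then show "((\<lambda>t. inner (y t) (y t)) has_real_derivative 2 * inner (y t) (cscale z (y t) + w t))
        (at t within {t0..})"
      unfolding has_real_derivative_iff_has_vector_derivative
      using bounded_bilinear.has_vector_derivative[OF bounded_bilinear_inner deriv deriv, of t]
      by (simp add: inner_commute)
  next
    fix t
    have "2 * inner (y t) (w t) \<le> 2 * (norm (y t) * norm (w t))"
      using norm_cauchy_schwarz[of "y t" "w t"] by simp
    also have "\<dots> \<le> c * (norm (y t))\<^sup>2 + (norm (w t))\<^sup>2 / c"
    proof -
      have "0 \<le> (c * norm (y t) - norm (w t))\<^sup>2 / c"
        using \<open>c > 0\<close> by simp
      also have "\<dots> = c * (norm (y t))\<^sup>2 + (norm (w t))\<^sup>2 / c - 2 * (norm (y t) * norm (w t))"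
        using \<open>c > 0\<close> by (simp add: power2_eq_square field_simps)
      finally show ?thesis by simp
    qed
    finally show "2 * inner (y t) (cscale z (y t) + w t)
        \<le> - c * inner (y t) (y t) + (norm (w t))\<^sup>2 / c"
      by (simp add: inner_add_right inner_cscale c_def power2_norm_eq_inner algebra_simps)
  next
    show "((\<lambda>t. (norm (w t))\<^sup>2 / c) \<longlongrightarrow> 0) at_top"
      using \<open>c > 0\<close> by (auto intro!: tendsto_eq_intros w)
  qed (use \<open>c > 0\<close> in auto)
  then have "((\<lambda>t. sqrt (inner (y t) (y t))) \<longlongrightarrow> sqrt 0) at_top"
    by (rule tendsto_real_sqrt)
  then show ?thesis
    by (simp add: norm_eq_sqrt_inner[symmetric] tendsto_norm_zero_iff)
qed

section \<open>Annihilating products of linear factors\<close>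

definition root_op :: "('b::real_vector \<times> 'b \<Rightarrow> 'b \<times> 'b) \<Rightarrow> complex \<Rightarrow> 'b \<times> 'b \<Rightarrow> 'b \<times> 'b" where
  "root_op F z v = F v - cscale z v"

abbreviation root_ops ::
  "('b::real_vector \<times> 'b \<Rightarrow> 'b \<times> 'b) \<Rightarrow> complex list \<Rightarrow> 'b \<times> 'b \<Rightarrow> 'b \<times> 'b" where
  "root_ops F \<equiv> foldr (root_op F)"

text \<open>Horner's scheme for \<open>p(F) v\<close>, with complex coefficients acting through
  \<open>cscale\<close>.\<close>

definition poly_op :: "('b::real_vector \<times> 'b \<Rightarrow> 'b \<times> 'b) \<Rightarrow> complex poly \<Rightarrow> 'b \<times> 'b \<Rightarrow> 'b \<times> 'b" where
  "poly_op F p v = fold_coeffs (\<lambda>c u. cscale c v + F u) p 0"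

context
  fixes f :: "'b::euclidean_space \<Rightarrow> 'b" and F :: "'b \<times> 'b \<Rightarrow> 'b \<times> 'b"
  assumes f: "linear f"
  defines F_def: "F \<equiv> map_prod f f"
begin

lemma linear_F: "linear F"
  by (rule linearI) (auto simp: F_def linear_add[OF f] linear_scale[OF f])

lemmas F_simps = linear_add[OF linear_F] linear_diff[OF linear_F] linear_scale[OF linear_F]
  linear_0[OF linear_F]

lemmas cscale_simps = linear_add[OF linear_cscale] linear_diff[OF linear_cscale]
  linear_scale[OF linear_cscale] linear_0[OF linear_cscale]

lemma F_cscale: "F (cscale z v) = cscale z (F v)"
  by (cases v)
    (simp add: F_def cscale_def linear_add[OF f] linear_diff[OF f] linear_scale[OF f])

lemma linear_root_op: "linear (root_op F z)"
  unfolding root_op_def by (intro linear_compose_sub linear_F linear_cscale)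

lemma root_op_commute: "root_op F z (root_op F w v) = root_op F w (root_op F z v)"
  by (simp add: root_op_def F_simps cscale_simps F_cscale cscale_cscale mult.commute)

lemma root_op_F: "root_op F z (F v) = F (root_op F z v)"
  by (simp add: root_op_def F_simps F_cscale)

lemma linear_root_ops: "linear (root_ops F zs)"
  by (induction zs)
    (auto simp: o_def id_def intro: linear_compose[OF _ linear_root_op, unfolded o_def] linear_id[unfolded id_def])

lemma root_op_root_ops: "root_op F z (root_ops F zs v) = root_ops F zs (root_op F z v)"
  by (induction zs) (auto simp: root_op_commute[of z])

lemma root_ops_commute: "root_ops F zs (root_ops F ws v) = root_ops F ws (root_ops F zs v)"
  by (induction zs) (auto simp: root_op_root_ops)

lemma root_ops_cscale: "root_ops F zs (cscale z v) = cscale z (root_ops F zs v)"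
  by (induction zs)
    (auto simp: root_op_def F_cscale cscale_simps cscale_cscale mult.commute)

lemma poly_op_pCons: "poly_op F (pCons c p) v = cscale c v + F (poly_op F p v)"
  by (cases "c = 0 \<and> p = 0") (auto simp: poly_op_def F_simps)

lemma poly_op_0 [simp]: "poly_op F 0 v = 0"
  by (simp add: poly_op_def)

lemma poly_op_add: "poly_op F (p + q) v = poly_op F p v + poly_op F q v"
proof (induction p arbitrary: q)
  case (pCons c p)
  then show ?case
    by (cases q) (simp add: poly_op_pCons cscale_add_left F_simps)
qed simp

lemma poly_op_smult: "poly_op F (smult c p) v = cscale c (poly_op F p v)"
  by (induction p) (auto simp: poly_op_pCons cscale_simps cscale_cscale F_cscale)

lemma poly_op_root: "poly_op F ([:- z, 1:] * p) v = root_op F z (poly_op F p v)"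
proof -
  have "[:- z, 1:] * p = smult (- z) p + pCons 0 p" by simp
  then show ?thesis
    using cscale_add_left[of z "- z" "poly_op F p v"]
    by (simp only: poly_op_add poly_op_smult poly_op_pCons root_op_def)
      (simp add: eq_neg_iff_add_eq_0 add.commute)
qed

lemma poly_op_monom: "poly_op F (monom c k) v = cscale c ((F ^^ k) v)"
  by (induction k) (auto simp: monom_0 monom_Suc poly_op_pCons F_simps F_cscale)

lemma poly_op_sum: "poly_op F (\<Sum>k\<in>K. p k) v = (\<Sum>k\<in>K. poly_op F (p k) v)"
  by (induction K rule: infinite_finite_induct) (auto simp: poly_op_add)

text \<open>Induction on the degree: the fundamental theorem of algebra yields a root
  \<open>z\<close> and \<open>p = (X - z) q\<close>. Since \<open>F - z\<close> commutes with
  \<open>q(F)\<close>, the polynomial \<open>q\<close> of smaller degree annihilates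
  \<open>(F - z) v\<close>. The nonzero constant left at the end can be cancelled.\<close>

lemma root_ops_of_poly_op:
  "p \<noteq> 0 \<Longrightarrow> poly_op F p v = 0 \<Longrightarrow> \<exists>zs. root_ops F zs v = 0"
proof (induction "degree p" arbitrary: p v)
  case 0
  then obtain c where "p = [:c:]" by (metis degree_eq_zeroE)
  with 0 have "v = 0" by (auto simp: poly_op_pCons F_simps dest: cscale_eq_0D)
  then have "root_ops F [] v = 0" by simp
  then show ?case by blast
next
  case (Suc n)
  then have "\<not> constant (poly p)"
    by (simp add: constant_degree)
  then obtain z where "poly p z = 0"
    using fundamental_theorem_of_algebra by blast
  then obtain q where q: "p = [:- z, 1:] * q"
    by (auto simp: poly_eq_0_iff_dvd)
  then have "q \<noteq> 0" "n = degree q"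
    using Suc.prems(1) Suc.hyps(2) degree_mult_eq[of "[:- z, 1:]" q] by (auto simp del: mult_pCons_left)
  have commute: "poly_op F r (root_op F z v) = root_op F z (poly_op F r v)" for r
    by (induction r)
      (simp_all add: poly_op_pCons linear_add[OF linear_root_op] linear_0[OF linear_root_op] root_op_F
        root_op_def[of F z "cscale _ _"] F_cscale cscale_cscale F_simps cscale_simps
        root_op_def[of F z v] mult.commute)
  have "poly_op F q (root_op F z v) = 0"
    using Suc.prems(2) unfolding q poly_op_root commute .
  from Suc.hyps(1)[OF \<open>n = degree q\<close> \<open>q \<noteq> 0\<close> this]
  obtain zs where "root_ops F (zs @ [z]) v = 0" by auto
  then show ?case by blast
qed

text \<open>The first \<open>DIM('b) + 1\<close> iterates of \<open>x\<close> under \<open>f\<close>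
  satisfy a nontrivial linear relation, whose coefficients form a nonzero polynomial that
  annihilates \<open>x\<close>.\<close>

lemma annihilating_root_ops_vector: "\<exists>zs. root_ops F zs (x, 0) = 0"
proof -
  define g where "g k = (f ^^ k) x" for k
  have F_pow: "(F ^^ k) (x, 0) = (g k, 0)" for k
    by (induction k) (auto simp: F_def g_def linear_0[OF f])
  \<comment> \<open>Linear dependence is a property of sets, so a repeated iterate has to be treated
    apart; there the relation has the coefficients 1 and -1.\<close>
  have "\<exists>K c k0. finite K \<and> k0 \<in> K \<and> c k0 \<noteq> 0 \<and> (\<Sum>k\<in>K. c k *\<^sub>R g k) = 0"
  proof (cases "inj_on g {..DIM('b)}")
    case True
    then have "card (g ` {..DIM('b)}) > DIM('b)"
      by (simp add: card_image)
    then have "dependent (g ` {..DIM('b)})"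
      by (intro dependent_biggerset) auto
    then obtain u v where u: "v \<in> g ` {..DIM('b)}" "u v \<noteq> 0"
        "(\<Sum>v\<in>g ` {..DIM('b)}. u v *\<^sub>R v) = 0"
      by (auto simp: dependent_finite)
    then obtain k0 where "k0 \<in> {..DIM('b)}" "u (g k0) \<noteq> 0" by auto
    moreover have "(\<Sum>k\<le>DIM('b). u (g k) *\<^sub>R g k) = 0"
      using u(3) by (simp add: sum.reindex[OF True])
    ultimately show ?thesis
      by (intro exI[of _ "{..DIM('b)}"] exI[of _ "\<lambda>k. u (g k)"] exI[of _ k0]) auto
  next
    case False
    then obtain k l where "g k = g l" "k \<noteq> l"
      by (auto simp: inj_on_def)
    then show ?thesis
      by (intro exI[of _ "{k, l}"] exI[of _ "\<lambda>m. if m = k then 1 else - 1"] exI[of _ k]) auto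
  qed
  then obtain K c k0 where K: "finite K" "k0 \<in> K" "c k0 \<noteq> 0" "(\<Sum>k\<in>K. c k *\<^sub>R g k) = 0"
    by blast
  define p where "p = (\<Sum>k\<in>K. monom (complex_of_real (c k)) k)"
  have "coeff p k0 = complex_of_real (c k0)"
    using K(1,2) by (simp add: p_def coeff_sum sum.delta)
  then have "p \<noteq> 0" using K(3) by auto
  moreover have "poly_op F p (x, 0) = (\<Sum>k\<in>K. c k *\<^sub>R g k, 0)"
    by (simp add: p_def poly_op_sum poly_op_monom cscale_of_real F_pow prod_eq_iff fst_sum snd_sum)
  ultimately show ?thesis
    using root_ops_of_poly_op[of p "(x, 0)"] K(4) by (simp add: zero_prod_def)
qed

text \<open>A weak substitute for the Cayley-Hamilton theorem. The factors commute, so concatenating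
  the lists of all basis vectors annihilates each of them; complex linearity extends this from real
  vectors \<open>(x, 0)\<close> to all pairs.\<close>

lemma annihilating_root_ops: "\<exists>zs. \<forall>v. root_ops F zs v = 0"
proof -
  have "\<exists>zs. \<forall>b\<in>B. root_ops F zs (b, 0) = 0" if "finite B" for B :: "'b set"
    using that
  proof induction
    case (insert b B)
    then obtain zs where zs: "\<forall>b\<in>B. root_ops F zs (b, 0) = 0" by blast
    obtain ws where "root_ops F ws (b, 0) = 0"
      using annihilating_root_ops_vector by blast
    then have "root_ops F (zs @ ws) (b, 0) = 0"
      by (simp add: linear_0[OF linear_root_ops])
    moreover have "root_ops F (zs @ ws) (c, 0) = 0" if "c \<in> B" for c
      using zs that root_ops_commute[of zs ws] by (simp add: linear_0[OF linear_root_ops])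
    ultimately show ?case by blast
  qed auto
  then obtain zs where zs: "\<And>b. b \<in> Basis \<Longrightarrow> root_ops F zs (b, 0) = 0"
    using finite_Basis by blast
  have lin: "linear (\<lambda>x. root_ops F zs (x, 0 :: 'b))"
    by (rule linear_compose[OF _ linear_root_ops, unfolded o_def])
      (rule linearI, auto)
  have real: "root_ops F zs (x, 0) = 0" for x
    using linear_eq_on_span[OF lin linear_zero, of Basis x] zs by (simp add: span_Basis)
  have "root_ops F zs (x, y) = 0" for x y
  proof -
    have "(x, y) = (x, 0) + cscale \<i> (y, 0)"
      by (simp add: cscale_def)
    then show ?thesis
      by (simp only: linear_add[OF linear_root_ops] root_ops_cscale real cscale_simps) simp
  qed
  then show ?thesis by (intro exI[of _ zs]) auto
qed

end

text \<open>
  Peel off one root \<open>z\<close> of the annihilating polynomial at a time: \<open>(F - z) y\<close> solves a forced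
  equation of the same kind, and it tends to \<open>0\<close> by induction.  If \<open>Re z < 0\<close>, then \<open>y\<close> solves a
  decaying scalar equation forced by it; otherwise \<open>z\<close> is no eigenvalue and \<open>F - z\<close> can be
  inverted.
\<close>

lemma stable_forced_tendsto_0_pair:
  fixes f :: "'b::euclidean_space \<Rightarrow> 'b"
  assumes f: "stable_map f"
  defines "F \<equiv> map_prod f f"
  assumes "\<And>t. t \<ge> t0 \<Longrightarrow> (y has_vector_derivative F (y t) + u t) (at t within {t0..})"
    and "(u \<longlongrightarrow> 0) at_top"
    and "\<And>t. root_ops F zs (y t) = 0"
  shows "(y \<longlongrightarrow> 0) at_top"
  using assms(3-)
proof (induction zs arbitrary: y u rule: rev_induct)
  case Nil
  then have "y = (\<lambda>_. 0)" by auto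
  then show ?case by simp
next
  case (snoc z zs)
  have f_lin: "linear f" using f by (simp add: stable_map_def)
  note F_rules = linear_F[OF f_lin, folded F_def] linear_root_op[OF f_lin, folded F_def]
    root_op_F[OF f_lin, folded F_def]
  note root_op_bl = F_rules(2)[unfolded linear_conv_bounded_linear]
  define y1 where "y1 t = root_op F z (y t)" for t
  have y1: "(y1 \<longlongrightarrow> 0) at_top"
  proof (rule snoc.IH[where u = "\<lambda>t. root_op F z (u t)"])
    fix t assume "t \<ge> t0"
    then have "(y1 has_vector_derivative root_op F z (F (y t) + u t)) (at t within {t0..})"
      unfolding y1_def by (intro bounded_linear.has_vector_derivative[OF root_op_bl] snoc.prems)
    then show "(y1 has_vector_derivative F (y1 t) + root_op F z (u t)) (at t within {t0..})"
      by (simp add: linear_add[OF F_rules(2)] F_rules(3) y1_def)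
  next
    show "((\<lambda>t. root_op F z (u t)) \<longlongrightarrow> 0) at_top"
      using bounded_linear.tendsto_zero[OF root_op_bl snoc.prems(2)] .
  next
    show "root_ops F zs (y1 t) = 0" for t
      using snoc.prems(3)[of t] by (simp add: y1_def)
  qed
  show ?case
  proof (cases "Re z < 0")
    case True
    show ?thesis
    proof (rule cscale_forced_tendsto_0[OF _ True])
      show "((\<lambda>t. y1 t + u t) \<longlongrightarrow> 0) at_top"
        using tendsto_add[OF y1 snoc.prems(2)] by simp
      show "(y has_vector_derivative cscale z (y t) + (y1 t + u t)) (at t within {t0..})"
        if "t \<ge> t0" for t
        using snoc.prems(1)[OF that] by (simp add: y1_def root_op_def)
    qed
  next
    case False
    have "inj (root_op F z)"
      unfolding linear_injective_0[OF F_rules(2)]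
    proof safe
      fix a b assume "root_op F z (a, b) = 0"
      then have "f a = Re z *\<^sub>R a - Im z *\<^sub>R b" "f b = Im z *\<^sub>R a + Re z *\<^sub>R b"
        by (auto simp: root_op_def F_def cscale_def zero_prod_def)
      with f False have "a = 0 \<and> b = 0"
        unfolding stable_map_def by (meson not_le)
      then show "(a, b) = 0" by (simp add: zero_prod_def)
    qed
    then obtain h where h: "linear h" "h \<circ> root_op F z = id"
      using linear_injective_left_inverse[OF F_rules(2)] by blast
    then have "y = (\<lambda>t. h (y1 t))"
      unfolding y1_def by (metis comp_apply id_apply)
    with bounded_linear.tendsto_zero[OF _ y1, of h] h(1) show ?thesis
      by (simp add: linear_conv_bounded_linear)
  qed
qed

section \<open>Forced responses of stable systems\<close>

lemma stable_forced_tendsto_0: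
  fixes y :: "real \<Rightarrow> 'b::euclidean_space"
  assumes f: "stable_map f"
    and deriv: "\<And>t. t \<ge> t0 \<Longrightarrow> (y has_vector_derivative f (y t) + u t) (at t within {t0..})"
    and u: "(u \<longlongrightarrow> 0) at_top"
  shows "(y \<longlongrightarrow> 0) at_top"
proof -
  have f_lin: "linear f" using f by (simp add: stable_map_def)
  obtain zs where zs: "\<And>v. root_ops (map_prod f f) zs v = 0"
    using annihilating_root_ops[OF f_lin] by blast
  have "((\<lambda>t. (y t, 0 :: 'b)) \<longlongrightarrow> 0) at_top"
  proof (rule stable_forced_tendsto_0_pair[OF f])
    show "((\<lambda>t. (u t, 0 :: 'b)) \<longlongrightarrow> 0) at_top"
      using tendsto_Pair[OF u tendsto_const[of 0]] by (simp add: zero_prod_def)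
    show "((\<lambda>t. (y t, 0)) has_vector_derivative map_prod f f (y t, 0) + (u t, 0)) (at t within {t0..})"
      if "t \<ge> t0" for t
      using has_vector_derivative_Pair[OF deriv[OF that] has_vector_derivative_const[of 0]]
      by (simp add: linear_0[OF f_lin])
  qed (rule zs)
  from tendsto_fst[OF this] show ?thesis by simp
qed

text \<open>The case \<open>\<alpha> = \<beta> = 0\<close> of the definition: 0 is not an
  eigenvalue.\<close>

lemma stable_map_inj: "stable_map f \<Longrightarrow> inj f"
  unfolding stable_map_def by (metis linear_0 linear_injective_0 order_refl scaleR_zero_left diff_0_right add_0)

text \<open>In finite dimension the injective \<open>f\<close> is surjective, so the limiting input
  has an equilibrium; the deviation from it obeys the same equation with vanishing input. The
  equilibrium equation is part of the conclusion because it later identifies the limit.\<close>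

lemma stable_forced_converges:
  fixes y :: "real \<Rightarrow> 'b::euclidean_space"
  assumes f: "stable_map f"
    and deriv: "\<And>t. t \<ge> t0 \<Longrightarrow> (y has_vector_derivative f (y t) + u t) (at t within {t0..})"
    and u: "(u \<longlongrightarrow> l) at_top"
  obtains y_lim where "(y \<longlongrightarrow> y_lim) at_top" "f y_lim + l = 0"
proof -
  have f_lin: "linear f" using f by (simp add: stable_map_def)
  then have "surj f"
    using linear_injective_imp_surjective stable_map_inj[OF f] by blast
  then obtain y_lim where y_lim: "f y_lim = - l" by (metis surjD)
  have "((\<lambda>t. y t - y_lim) \<longlongrightarrow> 0) at_top"
  proof (rule stable_forced_tendsto_0[OF f])
    show "((\<lambda>t. u t - l) \<longlongrightarrow> 0) at_top"
      using u by (simp add: LIM_zero_iff)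
    show "((\<lambda>t. y t - y_lim) has_vector_derivative f (y t - y_lim) + (u t - l)) (at t within {t0..})"
      if "t \<ge> t0" for t
      using has_vector_derivative_diff[OF deriv[OF that] has_vector_derivative_const[of y_lim]]
      by (simp add: linear_diff[OF f_lin] y_lim algebra_simps)
  qed
  then show ?thesis
    using that y_lim by (simp add: LIM_zero_iff)
qed

section \<open>Criteria for stability\<close>

text \<open>Pairing the two eigenvector equations with \<open>x\<close> and \<open>y\<close> and
  adding cancels the terms in \<open>\<beta>\<close>, so a nonpositive left side equals
  \<open>\<alpha>\<close> times a sum of squares.\<close>

lemma stable_map_negative_definite:
  assumes f: "linear f" and neg: "\<And>x. x \<noteq> 0 \<Longrightarrow> inner x (f x) < 0"
  shows "stable_map f"
  unfolding stable_map_def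
proof (intro conjI allI impI f)
  fix x y \<alpha> \<beta>
  assume *: "f x = \<alpha> *\<^sub>R x - \<beta> *\<^sub>R y" "f y = \<beta> *\<^sub>R x + \<alpha> *\<^sub>R y" "\<alpha> \<ge> 0"
  have "inner x (f x) + inner y (f y) = \<alpha> * (inner x x + inner y y)"
    by (simp add: * inner_diff_right inner_add_right inner_commute algebra_simps)
  with \<open>\<alpha> \<ge> 0\<close> have "inner x (f x) + inner y (f y) \<ge> 0"
    by simp
  moreover have "inner v (f v) \<le> 0" for v
    using neg[of v] by (cases "v = 0") auto
  ultimately have "\<not> inner x (f x) < 0" "\<not> inner y (f y) < 0"
    by (smt (verit))+
  then show "x = 0" "y = 0" using neg by blast+
qed

text \<open>A pair \<open>x\<close>, \<open>y\<close> as in \<open>stable_map\<close> is glued to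
  the complex vector with entries \<open>Complex (x $ i) (y $ i)\<close>, to which the definition of
  \<open>hurwitz\<close> applies.\<close>

lemma stable_map_hurwitz:
  fixes A :: "real ^ 'm ^ 'm"
  assumes "hurwitz A"
  shows "stable_map ((*v) A)"
  unfolding stable_map_def
proof (intro conjI allI impI)
  fix x y \<alpha> \<beta>
  assume *: "A *v x = \<alpha> *\<^sub>R x - \<beta> *\<^sub>R y" "A *v y = \<beta> *\<^sub>R x + \<alpha> *\<^sub>R y" and "\<alpha> \<ge> 0"
  define v where "v = (\<chi> i. Complex (x $ i) (y $ i))"
  have "map_matrix complex_of_real A *v v = Complex \<alpha> \<beta> *s v"
  proof -
    have "(map_matrix complex_of_real A *v v) $ i = Complex ((A *v x) $ i) ((A *v y) $ i)" for i
      by (simp add: v_def matrix_vector_mult_def map_matrix_def complex_eq_iff)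
    then show ?thesis
      by (simp add: vec_eq_iff * v_def complex_eq_iff)
  qed
  with assms \<open>\<alpha> \<ge> 0\<close> have "v = 0"
    unfolding hurwitz_def by (metis complex.sel(1) not_le)
  then show "x = 0" "y = 0"
    by (auto simp: v_def vec_eq_iff complex_eq_iff)
qed (rule matrix_vector_mul_linear)

text \<open>
  Besides the limit of \<open>\<phi>\<close>, the antiderivative \<open>g\<close> of its deviation from the limit converges:
  it is obtained by inverting \<open>f\<close> in \<open>\<phi>' = f (\<phi> - \<phi>_lim)\<close>.
\<close>

lemma stable_constant_input:
  fixes \<phi> :: "real \<Rightarrow> 'b::euclidean_space"
  assumes f: "stable_map f"
    and deriv: "\<And>t. t \<ge> t0 \<Longrightarrow> (\<phi> has_vector_derivative f (\<phi> t) + b) (at t within {t0..})"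
  obtains \<phi>_lim g g_lim where "(\<phi> \<longlongrightarrow> \<phi>_lim) at_top" "(g \<longlongrightarrow> g_lim) at_top"
    "\<And>t. t \<ge> t0 \<Longrightarrow> (g has_vector_derivative \<phi> t - \<phi>_lim) (at t within {t0..})"
proof -
  have f_lin: "linear f" using f by (simp add: stable_map_def)
  obtain \<phi>_lim where lim: "(\<phi> \<longlongrightarrow> \<phi>_lim) at_top" "f \<phi>_lim + b = 0"
    by (rule stable_forced_converges[OF f deriv tendsto_const]) auto
  obtain h where h: "linear h" "h \<circ> f = id"
    using linear_injective_left_inverse[OF f_lin stable_map_inj[OF f]] by blast
  have h_bl: "bounded_linear h" using h(1) by (simp add: linear_conv_bounded_linear)
  have "((\<lambda>t. h (\<phi> t)) has_vector_derivative \<phi> t - \<phi>_lim) (at t within {t0..})" if "t \<ge> t0" for t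
  proof -
    have "f (\<phi> t) + b = f (\<phi> t - \<phi>_lim)"
      using lim(2) by (simp add: linear_diff[OF f_lin] eq_neg_iff_add_eq_0[symmetric])
    with h(2) have "h (f (\<phi> t) + b) = \<phi> t - \<phi>_lim"
      by (simp add: fun_eq_iff)
    with bounded_linear.has_vector_derivative[OF h_bl deriv[OF that]] show ?thesis by simp
  qed
  with lim(1) bounded_linear.tendsto[OF h_bl lim(1)] show ?thesis by (rule that)
qed

section \<open>Averages, Laplacians and the secondary dynamics\<close>

lemma has_vector_derivative_vec_lambda:
  fixes f :: "real \<Rightarrow> 'm::finite \<Rightarrow> real"
  assumes "\<And>i. ((\<lambda>t. f t i) has_vector_derivative f' i) (at t within S)"
  shows "((\<lambda>t. \<chi> i. f t i) has_vector_derivative (\<chi> i. f' i)) (at t within S)"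
  using assms unfolding has_vector_derivative_def
  by - (rule has_derivative_componentwise_within[THEN iffD2], auto simp: Basis_vec_def inner_axis)

lemma has_vector_derivative_vec_nth:
  "(f has_vector_derivative f') (at t within S) \<Longrightarrow>
    ((\<lambda>t. f t $ i) has_vector_derivative f' $ i) (at t within S)"
  by (rule bounded_linear.has_vector_derivative[OF bounded_linear_vec_nth])

lemma linear_average: "linear (average :: real ^ 'n \<Rightarrow> real)"
  by (rule linearI) (auto simp: average_def sum.distrib sum_distrib_left add_divide_distrib)

lemmas average_simps = linear_add[OF linear_average] linear_diff[OF linear_average]
  linear_scale[OF linear_average] linear_0[OF linear_average]

lemma average_vec [simp]: "average (vec c :: real ^ 'n) = c"
  by (simp add: average_def)

lemma inner_vec_average: "inner x (vec c :: real ^ 'n) = real CARD('n) * c * average x"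
  by (simp add: inner_vec_def average_def sum_distrib_right[symmetric])

lemma bounded_linear_average: "bounded_linear (average :: real ^ 'n \<Rightarrow> real)"
  using linear_average by (simp add: linear_conv_bounded_linear)

lemma linear_vec_real: "linear (vec :: real \<Rightarrow> real ^ 'n)"
  by (rule linearI) (simp_all add: vec_eq_iff)

lemmas bounded_linear_vec = linear_vec_real[unfolded linear_conv_bounded_linear]

section \<open>Laplacians of connected weighted graphs\<close>

context
  fixes E :: "('n::finite \<times> 'n) set" and w :: "'n \<Rightarrow> 'n \<Rightarrow> real"
  assumes graph: "connected_graph E" and weights: "edge_weights E w"
begin

lemma laplacian_mult_component:
  "(laplacian E w *v x) $ i = (\<Sum>j\<in>E `` {i}. w i j * (x $ i - x $ j))"
proof -
  \<comment> \<open>Without loops the diagonal case and the neighbour case exclude each other, so a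
    row of the Laplacian splits into two separate sums.\<close>
  have "(i, i) \<notin> E" for i using graph by (simp add: connected_graph_def irrefl_def)
  then have "(laplacian E w *v x) $ i =
      (\<Sum>j\<in>UNIV. (if j = i then (\<Sum>k\<in>E `` {i}. w i k) * x $ i else 0)
        + (if j \<in> E `` {i} then - w i j * x $ j else 0))"
    unfolding matrix_vector_mult_def laplacian_def vec_lambda_beta
    by (intro sum.cong) auto
  also have "\<dots> = (\<Sum>k\<in>E `` {i}. w i k) * x $ i + (\<Sum>j\<in>E `` {i}. - w i j * x $ j)"
    by (simp only: sum.distrib sum.If_cases finite Collect_mem_eq Int_UNIV_left sum.delta UNIV_I if_True)
      (simp add: sum.delta)
  also have "\<dots> = (\<Sum>j\<in>E `` {i}. w i j * (x $ i - x $ j))"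
    by (simp add: sum_distrib_right sum_negf sum_subtractf right_diff_distrib)
  finally show ?thesis .
qed

lemma laplacian_symmetric: "transpose (laplacian E w) = laplacian E w"
  using graph weights
  by (auto simp: transpose_def laplacian_def vec_eq_iff connected_graph_def edge_weights_def
      dest: symD)

lemma inner_laplacian: "inner x (laplacian E w *v y) = inner (laplacian E w *v x) y"
  by (metis dot_lmul_matrix laplacian_symmetric vector_transpose_matrix)

lemma laplacian_vec [simp]: "laplacian E w *v vec c = 0"
  by (simp add: vec_eq_iff laplacian_mult_component)

text \<open>By symmetry the Laplacian can be moved onto the constant vector, which it
  annihilates.\<close>

lemma average_laplacian [simp]: "average (laplacian E w *v x) = 0"
  using inner_laplacian[of "vec 1" x] inner_vec_average[of "laplacian E w *v x" 1]
    laplacian_vec[of 1]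
  by (simp add: inner_commute)

text \<open>Since \<open>E\<close> contains both orientations of each edge, the sum of
  \<open>w i j * (x $ i - x $ j)\<^sup>2\<close> over \<open>E\<close> is twice the inner product of
  \<open>x\<close> with its Laplacian image. If it vanishes, \<open>x\<close> is constant along
  edges, and by connectedness everywhere.\<close>

lemma laplacian_eq_0D:
  assumes "laplacian E w *v x = 0"
  shows "x = vec (average x)"
proof -
  have swap: "(\<Sum>(i, j)\<in>E. g i j) = (\<Sum>(i, j)\<in>E. g j i)" for g :: "'n \<Rightarrow> 'n \<Rightarrow> real"
    using graph by (intro sum.reindex_bij_witness[of _ prod.swap prod.swap])
      (auto simp: connected_graph_def dest: symD)
  have sym_w: "w j i = w i j" if "(i, j) \<in> E" for i j
    using weights that by (auto simp: edge_weights_def)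
  have "0 = inner x (laplacian E w *v x)" using assms by simp
  also have "\<dots> = (\<Sum>i\<in>UNIV. \<Sum>j\<in>E `` {i}. w i j * (x $ i - x $ j) * x $ i)"
    by (simp add: inner_vec_def laplacian_mult_component sum_distrib_left sum_distrib_right mult_ac)
  also have "\<dots> = (\<Sum>(i, j)\<in>(SIGMA i:UNIV. E `` {i}). w i j * (x $ i - x $ j) * x $ i)"
    by (rule sum.Sigma) auto
  also have "(SIGMA i:UNIV. E `` {i}) = E" by auto
  finally have 1: "(\<Sum>(i, j)\<in>E. w i j * (x $ i - x $ j) * x $ i) = 0" by simp
  then have 2: "(\<Sum>(i, j)\<in>E. w j i * (x $ j - x $ i) * x $ j) = 0"
    by (subst (asm) swap)
  have "(\<Sum>(i, j)\<in>E. w i j * (x $ i - x $ j)\<^sup>2) =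
      (\<Sum>(i, j)\<in>E. w i j * (x $ i - x $ j) * x $ i) + (\<Sum>(i, j)\<in>E. w j i * (x $ j - x $ i) * x $ j)"
    unfolding sum.distrib[symmetric]
    by (intro sum.cong) (auto simp: sym_w power2_eq_square algebra_simps)
  with 1 2 have "(\<Sum>(i, j)\<in>E. w i j * (x $ i - x $ j)\<^sup>2) = 0" by simp
  moreover have pos: "w i j > 0" if "(i, j) \<in> E" for i j
    using weights that by (auto simp: edge_weights_def)
  ultimately have "\<forall>(i, j)\<in>E. w i j * (x $ i - x $ j)\<^sup>2 = 0"
    by (subst (asm) sum_nonneg_eq_0_iff) (auto simp: less_imp_le)
  then have edge: "x $ i = x $ j" if "(i, j) \<in> E" for i j
    using that pos[OF that] by auto
  have "x $ i = x $ j" for i j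
  proof -
    have "(i, j) \<in> E\<^sup>*" using graph by (simp add: connected_graph_def)
    then show ?thesis by induction (auto simp: edge)
  qed
  \<comment> \<open>Here \<open>undefined\<close> merely names some node.\<close>
  then have "x = vec (x $ undefined)" by (auto simp: vec_eq_iff)
  then show ?thesis by (metis average_vec)
qed

section \<open>Secondary control dynamics\<close>

text \<open>Separates the feedback from the false data, which become an additive input. The
  reference voltage disappears because the Laplacian annihilates constants.\<close>

lemma secondary_derivative:
  assumes "secondary_solution E w kI Is Vref il \<delta> \<psi>" "t \<ge> 0"
  shows "(\<psi> has_vector_derivative
      - kI *\<^sub>R (laplacian E w *v (\<chi> i. (laplacian E w *v \<psi> t + il) $ i / Is i))
      + kI *\<^sub>R (\<chi> i. \<Sum>j\<in>E `` {i}. w i j * \<delta> i j t / Is j)) (at t within {0..})"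
proof -
  have "voltages Vref (\<psi> t) = vec Vref + \<psi> t"
    by (simp add: voltages_def vec_eq_iff)
  then have I: "output_currents E w il (voltages Vref (\<psi> t)) = laplacian E w *v \<psi> t + il"
    by (simp add: output_currents_def matrix_vector_right_distrib)
  have "- kI *\<^sub>R (laplacian E w *v (\<chi> i. y $ i / Is i))
      + kI *\<^sub>R (\<chi> i. \<Sum>j\<in>E `` {i}. w i j * \<delta> i j t / Is j)
      = (\<chi> i. - kI * (\<Sum>j\<in>E `` {i}. w i j * (y $ i / Is i - (y $ j + \<delta> i j t) / Is j)))" for y
    by (auto simp: vec_eq_iff laplacian_mult_component sum_distrib_left sum.distrib[symmetric]
        sum_negf[symmetric] add_divide_distrib algebra_simps intro!: sum.cong)
  then show ?thesis
    using assms(1)[unfolded secondary_solution_def Let_def, rule_format, OF assms(2)]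
    by (simp only: I)
qed

lemma secondary_average_derivative:
  assumes "secondary_solution E w kI Is Vref il \<delta> \<psi>" "t \<ge> 0"
  shows "((\<lambda>t. average (\<psi> t)) has_real_derivative
      kI * average (\<chi> i. \<Sum>j\<in>E `` {i}. w i j * \<delta> i j t / Is j)) (at t within {0..})"
  using bounded_linear.has_vector_derivative[OF bounded_linear_average secondary_derivative[OF assms]]
  by (simp add: has_real_derivative_iff_has_vector_derivative average_simps)

text \<open>With \<open>L\<close> the Laplacian and \<open>D\<close> the diagonal matrix of the
  \<open>1 / Is i\<close>, the matrix \<open>- kI L D L\<close> is negative semidefinite with the
  constant vectors as kernel. Subtracting the mean makes the quadratic form negative definite and
  changes nothing on vectors of mean 0.\<close>

lemma stable_map_secondary:
  assumes kI: "kI > 0" and Is: "\<And>j. Is j > 0"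
  shows "stable_map (\<lambda>x. - kI *\<^sub>R (laplacian E w *v (\<chi> i. (laplacian E w *v x) $ i / Is i))
    - vec (average x))"
proof (rule stable_map_negative_definite)
  show "linear (\<lambda>x. - kI *\<^sub>R (laplacian E w *v (\<chi> i. (laplacian E w *v x) $ i / Is i))
      - vec (average x))"
  proof -
    have lin_D: "linear (\<lambda>x. \<chi> i. (laplacian E w *v x) $ i / Is i)"
      by (rule linearI)
        (auto simp: vec_eq_iff matrix_vector_right_distrib matrix_vector_mult_scaleR add_divide_distrib)
    show ?thesis
      by (intro linear_compose_sub linear_compose_scale_right
          linear_compose[OF lin_D matrix_vector_mul_linear, unfolded o_def]
          linear_compose[OF linear_average linear_vec_real, unfolded o_def])
  qed
next
  fix x :: "real ^ 'n" assume "x \<noteq> 0"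
  define y where "y = laplacian E w *v x"
  define q where "q = (\<Sum>i\<in>UNIV. (y $ i)\<^sup>2 / Is i)"
  have "inner x (laplacian E w *v (\<chi> i. y $ i / Is i)) = q"
    by (subst inner_laplacian) (simp add: y_def[symmetric] q_def inner_vec_def power2_eq_square)
  then have eq: "inner x (- kI *\<^sub>R (laplacian E w *v (\<chi> i. y $ i / Is i)) - vec (average x))
      = - (kI * q + real CARD('n) * (average x)\<^sup>2)"
    by (simp add: inner_diff_right inner_vec_average power2_eq_square)
  have q: "q \<ge> 0" unfolding q_def using Is by (intro sum_nonneg) (simp add: less_imp_le)
  have "kI * q + real CARD('n) * (average x)\<^sup>2 \<noteq> 0"
  proof
    assume "kI * q + real CARD('n) * (average x)\<^sup>2 = 0"
    moreover have "kI * q \<ge> 0" "real CARD('n) * (average x)\<^sup>2 \<ge> 0"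
      using kI q by auto
    ultimately have "kI * q = 0" "real CARD('n) * (average x)\<^sup>2 = 0" by linarith+
    then have "q = 0" "average x = 0" using kI by auto
    then have "(y $ i)\<^sup>2 / Is i = 0" for i
      unfolding q_def using Is by (subst (asm) sum_nonneg_eq_0_iff) (auto simp: less_imp_le)
    then have "y = 0" using Is by (auto simp: vec_eq_iff less_le)
    then have "x = vec 0" using laplacian_eq_0D[of x] \<open>average x = 0\<close> by (simp add: y_def)
    with \<open>x \<noteq> 0\<close> show False by simp
  qed
  moreover have "kI * q + real CARD('n) * (average x)\<^sup>2 \<ge> 0"
    using kI q by auto
  ultimately show "inner x (- kI *\<^sub>R (laplacian E w *v (\<chi> i. (laplacian E w *v x) $ i / Is i))
      - vec (average x)) < 0"
    using eq by (simp add: y_def)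
qed

text \<open>The deviation has mean 0, so it follows the map of \<open>stable_map_secondary\<close>.
  Its input collects the false data without their mean and the constant load term, and converges
  even when the mean of \<open>\<psi>\<close> is a ramp.\<close>

lemma secondary_deviation_converges:
  assumes kI: "kI > 0" and Is: "\<And>j. Is j > 0"
    and sol: "secondary_solution E w kI Is Vref il \<delta> \<psi>"
    and \<delta>: "\<And>i j. (i, j) \<in> E \<Longrightarrow> (\<delta> i j \<longlongrightarrow> \<delta>_lim i j) at_top"
  obtains x where "((\<lambda>t. \<psi> t - vec (average (\<psi> t))) \<longlongrightarrow> x) at_top"
proof -
  define F where "F t = (\<chi> i. \<Sum>j\<in>E `` {i}. w i j * \<delta> i j t / Is j)" for t
  define b where "b = laplacian E w *v (\<chi> i. il $ i / Is i)"
  define f where "f x = - kI *\<^sub>R (laplacian E w *v (\<chi> i. (laplacian E w *v x) $ i / Is i))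
    - vec (average x)" for x
  have F: "(F \<longlongrightarrow> (\<chi> i. \<Sum>j\<in>E `` {i}. w i j * \<delta>_lim i j / Is j)) at_top"
    unfolding F_def using Is by (intro tendsto_intros \<delta>) (auto simp: less_le)
  have "stable_map f"
    unfolding f_def by (rule stable_map_secondary[OF kI Is])
  moreover have "((\<lambda>t. \<psi> t - vec (average (\<psi> t))) has_vector_derivative
      f (\<psi> t - vec (average (\<psi> t))) + (kI *\<^sub>R F t - kI *\<^sub>R b - vec (kI * average (F t))))
      (at t within {0..})" if "t \<ge> 0" for t
  proof -
    have "(\<chi> i. (laplacian E w *v \<psi> t + il) $ i / Is i)
        = (\<chi> i. (laplacian E w *v \<psi> t) $ i / Is i) + (\<chi> i. il $ i / Is i)"
      by (simp add: vec_eq_iff add_divide_distrib)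
    then have "- kI *\<^sub>R (laplacian E w *v (\<chi> i. (laplacian E w *v \<psi> t + il) $ i / Is i)) + kI *\<^sub>R F t
        - vec (kI * average (F t))
        = f (\<psi> t - vec (average (\<psi> t))) + (kI *\<^sub>R F t - kI *\<^sub>R b - vec (kI * average (F t)))"
      by (simp add: f_def b_def average_simps matrix_vector_right_distrib
          matrix_vector_mult_diff_distrib algebra_simps)
    moreover have "((\<lambda>t. \<psi> t - vec (average (\<psi> t))) has_vector_derivative
        - kI *\<^sub>R (laplacian E w *v (\<chi> i. (laplacian E w *v \<psi> t + il) $ i / Is i)) + kI *\<^sub>R F t
        - vec (kI * average (F t))) (at t within {0..})"
      unfolding F_def
      by (intro has_vector_derivative_diff secondary_derivative[OF sol that]
          bounded_linear.has_vector_derivative[OF bounded_linear_vec]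
          secondary_average_derivative[OF sol that,
            unfolded has_real_derivative_iff_has_vector_derivative])
    ultimately show ?thesis by (simp only:)
  qed
  moreover have "((\<lambda>t. kI *\<^sub>R F t - kI *\<^sub>R b - vec (kI * average (F t))) \<longlongrightarrow>
      kI *\<^sub>R (\<chi> i. \<Sum>j\<in>E `` {i}. w i j * \<delta>_lim i j / Is j) - kI *\<^sub>R b
      - vec (kI * average (\<chi> i. \<Sum>j\<in>E `` {i}. w i j * \<delta>_lim i j / Is j))) at_top"
    by (intro tendsto_diff tendsto_scaleR tendsto_const F tendsto_mult
        bounded_linear.tendsto[OF bounded_linear_vec] bounded_linear.tendsto[OF bounded_linear_average])
  ultimately show ?thesis
    by (rule stable_forced_converges) (auto intro: that)
qed

end

section \<open>Tracking of the mean voltage by the estimators\<close>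

text \<open>The Routh-Hurwitz criterion for a cubic, done by hand. For nonreal \<open>z\<close> the
  imaginary part determines \<open>n * y\<^sup>2\<close>; inserting it into the real part gives a
  sum of nonnegative terms, one of them positive, that would have to vanish. For real
  \<open>z\<close> this already holds for the real part itself.\<close>

lemma cubic_root_Re_neg:
  fixes z :: complex and a m n :: real
  assumes eq: "z\<^sup>2 * (z + a) * n = - (2 * a * z + a\<^sup>2) * m"
    and pos: "a > 0" "m > 0" "n > 0"
  shows "Re z < 0"
proof (rule ccontr)
  define x y where "x = Re z" and "y = Im z"
  assume "\<not> Re z < 0"
  then have x: "x \<ge> 0" by (simp add: x_def)
  have z: "z = Complex x y" by (simp add: x_def y_def)
  have re: "n * (x^3 - 3 * x * y\<^sup>2 + a * (x\<^sup>2 - y\<^sup>2)) + 2 * a * m * x + a\<^sup>2 * m = 0"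
    using arg_cong[OF eq, of Re]
    by (simp add: z power2_eq_square power3_eq_cube algebra_simps)
  have im: "y * (n * (3 * x\<^sup>2 - y\<^sup>2 + 2 * a * x) + 2 * a * m) = 0"
    using arg_cong[OF eq, of Im]
    by (simp add: z power2_eq_square power3_eq_cube algebra_simps)
  have nonneg: "n * x^3 \<ge> 0" "n * a * x\<^sup>2 \<ge> 0" "n * a\<^sup>2 * x \<ge> 0" "a * m * x \<ge> 0" "a\<^sup>2 * m > 0"
    using x pos by auto
  show False
  proof (cases "y = 0")
    case True
    with re have "n * x^3 + n * a * x\<^sup>2 + 2 * (a * m * x) + a\<^sup>2 * m = 0"
      by (simp add: algebra_simps)
    with nonneg show False by linarith
  next
    case False
    with im have "n * (3 * x\<^sup>2 - y\<^sup>2 + 2 * a * x) + 2 * a * m = 0"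
      by simp
    then have "n * y\<^sup>2 = n * (3 * x\<^sup>2 + 2 * a * x) + 2 * a * m"
      by (simp add: algebra_simps)
    moreover have "n * (x^3 - 3 * x * y\<^sup>2 + a * (x\<^sup>2 - y\<^sup>2)) = n * x^3 + n * a * x\<^sup>2 - (3 * x + a) * (n * y\<^sup>2)"
      by (simp add: algebra_simps)
    ultimately have "n * x^3 + n * a * x\<^sup>2 - (3 * x + a) * (n * (3 * x\<^sup>2 + 2 * a * x) + 2 * a * m)
        + 2 * a * m * x + a\<^sup>2 * m = 0"
      using re by simp
    then have "8 * (n * x^3) + 8 * (n * a * x\<^sup>2) + 2 * (n * a\<^sup>2 * x) + 4 * (a * m * x) + a\<^sup>2 * m = 0"
      by (simp add: algebra_simps power2_eq_square power3_eq_cube)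
    with nonneg show False by linarith
  qed
qed

text \<open>On pairs, \<open>inner\<close> is the real part of the Hermitian product, and pairing
  with \<open>cscale \<i> v\<close> gives the imaginary part. For self-adjoint \<open>f\<close> the
  Hermitian form of \<open>f\<close> is real, so \<open>c\<close> can be read off.\<close>

lemma inner_cscale_self_adjoint:
  assumes adj: "\<And>x y. inner x (f y) = inner (f x) y"
  shows "inner v (cscale c (map_prod f f v)) = Re c * inner v (map_prod f f v)"
    and "inner (cscale \<i> v) (cscale c (map_prod f f v)) = Im c * inner v (map_prod f f v)"
  using adj[of "fst v" "snd v"]
  by (cases v; simp add: cscale_def inner_Pair algebra_simps inner_commute)+

text \<open>
  The estimator dynamics in the states \<open>p\<close>, \<open>q\<close> of the first filter (relative to the mean) and the
  images \<open>r\<close>, \<open>s\<close> of the states of the second one under the Laplacian \<open>l\<close>.  The latter have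
  average \<open>0\<close>, so the two terms with \<open>vec\<close> vanish on trajectories; they make the map stable on
  the whole space.
\<close>

definition dac_map ::
  "(real ^ 'n \<Rightarrow> real ^ 'n) \<Rightarrow> real \<Rightarrow> real \<Rightarrow>
    (real ^ 'n) \<times> (real ^ 'n) \<times> (real ^ 'n) \<times> (real ^ 'n) \<Rightarrow> (real ^ 'n) \<times> (real ^ 'n) \<times> (real ^ 'n) \<times> (real ^ 'n)"
  where
  "dac_map l \<gamma> a = (\<lambda>(p, q, r, s).
     (- (2 * a) *\<^sub>R p - a\<^sup>2 *\<^sub>R q - \<gamma> *\<^sub>R (r + a *\<^sub>R s), p,
      \<gamma> *\<^sub>R l (l ((2 * a) *\<^sub>R p + a\<^sup>2 *\<^sub>R q)) - vec (average r), r - vec (average s)))"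

lemma linear_dac_map:
  assumes l: "linear l"
  shows "linear (dac_map l \<gamma> a)"
  by (rule linearI)
    (auto simp: dac_map_def linear_add[OF l] linear_scale[OF l] average_simps
      linear_add[OF linear_vec_real] linear_scale[OF linear_vec_real, simplified] algebra_simps)

context
  fixes E :: "('n::finite \<times> 'n) set" and w :: "'n \<Rightarrow> 'n \<Rightarrow> real"
  assumes graph: "connected_graph E" and weights: "edge_weights E w"
begin

text \<open>
  Eliminating the other components from an eigenvector with \<open>Re z \<ge> 0\<close> leaves
  \<open>z\<^sup>2 (z + a) s = - \<gamma>\<^sup>2 (2 a z + a\<^sup>2) l (l s)\<close>; the inner product with \<open>s\<close> gives the cubic of
  \<open>cubic_root_Re_neg\<close>.
\<close>

lemma stable_map_dac:
  assumes a: "a > 0" and \<gamma>: "\<gamma> > 0"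
  shows "stable_map (dac_map ((*v) (laplacian E w)) \<gamma> a)"
  unfolding stable_map_def
proof (intro conjI linear_dac_map matrix_vector_mul_linear, clarify)
  fix P Q R S P' Q' R' S' :: "real ^ 'n" and \<alpha> \<beta> :: real
  define l where "l = (*v) (laplacian E w)"
  define g where "g x = l (l x)" for x
  have l: "linear l" by (simp add: l_def)
  then have g: "linear g"
    unfolding g_def using linear_compose[OF l l] by (simp add: o_def)
  assume "dac_map ((*v) (laplacian E w)) \<gamma> a (P, Q, R, S) = \<alpha> *\<^sub>R (P, Q, R, S) - \<beta> *\<^sub>R (P', Q', R', S')"
    and "dac_map ((*v) (laplacian E w)) \<gamma> a (P', Q', R', S') = \<beta> *\<^sub>R (P, Q, R, S) + \<alpha> *\<^sub>R (P', Q', R', S')"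
    and \<alpha>: "\<alpha> \<ge> 0"
  then have p: "- (2 * a) *\<^sub>R P - a\<^sup>2 *\<^sub>R Q - \<gamma> *\<^sub>R (R + a *\<^sub>R S) = \<alpha> *\<^sub>R P - \<beta> *\<^sub>R P'"
      "- (2 * a) *\<^sub>R P' - a\<^sup>2 *\<^sub>R Q' - \<gamma> *\<^sub>R (R' + a *\<^sub>R S') = \<beta> *\<^sub>R P + \<alpha> *\<^sub>R P'"
    and q: "P = \<alpha> *\<^sub>R Q - \<beta> *\<^sub>R Q'" "P' = \<beta> *\<^sub>R Q + \<alpha> *\<^sub>R Q'"
    and r: "\<gamma> *\<^sub>R g ((2 * a) *\<^sub>R P + a\<^sup>2 *\<^sub>R Q) - vec (average R) = \<alpha> *\<^sub>R R - \<beta> *\<^sub>R R'"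
      "\<gamma> *\<^sub>R g ((2 * a) *\<^sub>R P' + a\<^sup>2 *\<^sub>R Q') - vec (average R') = \<beta> *\<^sub>R R + \<alpha> *\<^sub>R R'"
    and s: "R - vec (average S) = \<alpha> *\<^sub>R S - \<beta> *\<^sub>R S'" "R' - vec (average S') = \<beta> *\<^sub>R S + \<alpha> *\<^sub>R S'"
    unfolding dac_map_def g_def l_def prod.case scaleR_Pair diff_Pair add_Pair prod.inject
    by blast+
  have average_g: "average (g x) = 0" for x
    by (simp add: g_def l_def average_laplacian[OF graph weights])
  \<comment> \<open>This is the invertibility of \<open>z + 1\<close> for
    \<open>\<alpha> \<ge> 0\<close>. Averaging the equations for \<open>R\<close> and then
    \<open>S\<close> leads to it, so both have mean 0 and the \<open>vec\<close> terms drop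
    out.\<close>
  have zero: "x = 0 \<and> y = 0" if "- x = \<alpha> * x - \<beta> * y" "- y = \<beta> * x + \<alpha> * y" for x y :: real
  proof -
    have "((\<alpha> + 1)\<^sup>2 + \<beta>\<^sup>2) * x = (\<alpha> + 1) * (\<alpha> * x - \<beta> * y + x) + \<beta> * (\<beta> * x + \<alpha> * y + y)"
      "((\<alpha> + 1)\<^sup>2 + \<beta>\<^sup>2) * y = (\<alpha> + 1) * (\<beta> * x + \<alpha> * y + y) - \<beta> * (\<alpha> * x - \<beta> * y + x)"
      by (simp_all add: power2_eq_square algebra_simps)
    then have "((\<alpha> + 1)\<^sup>2 + \<beta>\<^sup>2) * x = 0" "((\<alpha> + 1)\<^sup>2 + \<beta>\<^sup>2) * y = 0"
      by (simp_all add: that[symmetric])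
    then show ?thesis using \<alpha> by auto
  qed
  have R0: "average R = 0 \<and> average R' = 0"
    using r[THEN arg_cong[where f = average]] by (intro zero) (simp_all add: average_simps average_g)
  have S0: "average S = 0 \<and> average S' = 0"
    using s[THEN arg_cong[where f = average]] R0 by (intro zero) (simp_all add: average_simps)
  define z where "z = Complex \<alpha> \<beta>"
  define Qc Sc where "Qc = (Q, Q')" and "Sc = (S, S')"
  define G where "G = map_prod g g"
  have Pc: "(P, P') = cscale z Qc" and Rc: "(R, R') = cscale z Sc"
    using q s R0 S0 by (simp_all add: cscale_def z_def Qc_def Sc_def)
  have G: "linear G" and G_cscale: "G (cscale c v) = cscale c (G v)" for c v
    unfolding G_def by (rule linear_F[OF g], rule F_cscale[OF g])
  have "cscale z (cscale z Qc) = - (2 * a) *\<^sub>R cscale z Qc - a\<^sup>2 *\<^sub>R Qc - \<gamma> *\<^sub>R (cscale z Sc + a *\<^sub>R Sc)"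
    using p unfolding Pc[symmetric] Rc[symmetric] by (simp add: cscale_def z_def Qc_def Sc_def)
  \<comment> \<open>The first filter is critically damped,
    \<open>z\<^sup>2 + 2 a z + a\<^sup>2 = (z + a)\<^sup>2\<close>, and \<open>R = z S\<close> turns
    \<open>R + a S\<close> into \<open>(z + a) S\<close>. Thus one factor \<open>z + a\<close> can
    be cancelled.\<close>
  moreover have "cscale (z + a) (cscale (z + a) Qc + \<gamma> *\<^sub>R Sc) =
      cscale z (cscale z Qc) + (2 * a) *\<^sub>R cscale z Qc + a\<^sup>2 *\<^sub>R Qc + \<gamma> *\<^sub>R (cscale z Sc + a *\<^sub>R Sc)"
    by (simp add: cscale_def prod_eq_iff vec_eq_iff algebra_simps power2_eq_square)
  ultimately have "cscale (z + a) (cscale (z + a) Qc + \<gamma> *\<^sub>R Sc) = 0"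
    by simp
  moreover have za: "z + a \<noteq> 0"
    using \<alpha> a by (auto simp: z_def complex_eq_iff)
  ultimately have "cscale (z + a) Qc + \<gamma> *\<^sub>R Sc = 0"
    by (rule cscale_eq_0D)
  then have QS: "cscale (z + a) Qc = - \<gamma> *\<^sub>R Sc"
    by (simp add: eq_neg_iff_add_eq_0)
  have "cscale z (cscale z Sc) = \<gamma> *\<^sub>R G ((2 * a) *\<^sub>R cscale z Qc + a\<^sup>2 *\<^sub>R Qc)"
    using r R0 unfolding Pc[symmetric] Rc[symmetric] by (simp add: cscale_def z_def Qc_def G_def)
  also have "(2 * a) *\<^sub>R cscale z Qc + a\<^sup>2 *\<^sub>R Qc = cscale (2 * a * z + a\<^sup>2) Qc"
    by (simp add: cscale_def prod_eq_iff vec_eq_iff algebra_simps power2_eq_square)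
  finally have "cscale (z + a) (cscale z (cscale z Sc)) =
      cscale (z + a) (\<gamma> *\<^sub>R G (cscale (2 * a * z + a\<^sup>2) Qc))"
    by (rule arg_cong)
  also have "\<dots> = \<gamma> *\<^sub>R G (cscale (2 * a * z + a\<^sup>2) (cscale (z + a) Qc))"
    by (simp only: linear_scale[OF linear_cscale] G_cscale cscale_cscale mult.commute)
  also have "\<dots> = cscale (- (2 * a * z + a\<^sup>2) * complex_of_real (\<gamma>\<^sup>2)) (G Sc)"
    unfolding QS linear_scale[OF linear_cscale] G_cscale linear_scale[OF G]
    by (simp add: cscale_def prod_eq_iff vec_eq_iff algebra_simps power2_eq_square)
  finally have main: "cscale (z\<^sup>2 * (z + a)) Sc =
      cscale (- (2 * a * z + a\<^sup>2) * complex_of_real (\<gamma>\<^sup>2)) (G Sc)"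
    by (simp add: cscale_cscale power2_eq_square mult_ac)
  define m where "m = inner Sc (G Sc)"
  have adj: "inner x (g y) = inner (g x) y" for x y
    by (simp add: g_def l_def inner_laplacian[OF graph weights])
  have scale_eqI: "c * complex_of_real x = d * complex_of_real y"
    if "Re c * x = Re d * y" "Im c * x = Im d * y" for c d x y
    using that by (simp add: complex_eq_iff)
  have "Re (z\<^sup>2 * (z + a)) * inner Sc Sc = Re (- (2 * a * z + a\<^sup>2) * complex_of_real (\<gamma>\<^sup>2)) * m"
    "Im (z\<^sup>2 * (z + a)) * inner Sc Sc = Im (- (2 * a * z + a\<^sup>2) * complex_of_real (\<gamma>\<^sup>2)) * m"
    using arg_cong[OF main, of "inner Sc"] arg_cong[OF main, of "inner (cscale \<i> Sc)"]
    unfolding G_def m_def inner_cscale_self_adjoint[OF adj]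
      inner_cscale_self_adjoint[where f = id, unfolded prod.map_id0 id_apply, OF refl] by simp_all
  from scale_eqI[OF this] have cubic: "z\<^sup>2 * (z + a) * complex_of_real (inner Sc Sc) =
      - (2 * a * z + a\<^sup>2) * complex_of_real (\<gamma>\<^sup>2 * m)"
    by (simp only: of_real_mult mult.assoc)
  have m: "m = inner (l S) (l S) + inner (l S') (l S')"
    by (simp add: m_def G_def Sc_def g_def l_def inner_Pair inner_laplacian[OF graph weights])
  have "Sc = 0"
  proof (rule ccontr)
    assume "Sc \<noteq> 0"
    moreover have "x = 0" if "l x = 0" "average x = 0" for x
      using laplacian_eq_0D[OF graph weights, of x] that by (simp add: l_def)
    ultimately have "l S \<noteq> 0 \<or> l S' \<noteq> 0"
      using S0 by (auto simp: Sc_def zero_prod_def)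
    then have "m > 0"
      unfolding m by (auto intro: add_pos_nonneg add_nonneg_pos)
    with cubic_root_Re_neg[OF cubic a] \<gamma> \<open>Sc \<noteq> 0\<close> \<alpha> show False
      by (simp add: z_def)
  qed
  moreover from this have "Qc = 0"
    using QS za by (auto intro: cscale_eq_0D)
  ultimately have "(P, P') = 0" "(R, R') = 0" "Qc = 0" "Sc = 0"
    using Pc Rc by (simp_all add: linear_0[OF linear_cscale])
  then show "(P, Q, R, S) = 0 \<and> (P', Q', R', S') = 0"
    by (simp add: Qc_def Sc_def zero_prod_def)
qed

section \<open>Convergence of the estimates to the mean\<close>

lemma dac_tracks_average:
  assumes a: "a > 0" and \<gamma>: "\<gamma> > 0"
    and dac: "dac_solution E w \<gamma> a v X1 X2"
    and v: "\<And>t. t \<ge> 0 \<Longrightarrow> v t = vec (m t) + x t"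
    and m: "\<And>t. t \<ge> 0 \<Longrightarrow> (m has_real_derivative m' t) (at t within {0..})"
    and m': "(m' \<longlongrightarrow> slope) at_top"
    and x: "(x \<longlongrightarrow> x_lim) at_top" "average x_lim = 0"
  shows "((\<lambda>t. C1 a \<bullet> X1 i t - m t) \<longlongrightarrow> 0) at_top"
proof -
  define l where "l = (*v) (laplacian E w)"
  have l: "linear l" by (simp add: l_def)
  have average_l: "average (l y) = 0" for y
    by (simp add: l_def average_laplacian[OF graph weights])
  define p q r s where "p t = (\<chi> i. X1 i t $ 1)" and "q t = (\<chi> i. X1 i t $ 2)"
    and "r t = (\<chi> i. X2 i t $ 1)" and "s t = (\<chi> i. X2 i t $ 2)" for t
  have C1_inner: "C1 a \<bullet> y = 2 * a * y $ 1 + a\<^sup>2 * y $ 2" for y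
    by (simp add: C1_def inner_vec_def sum_2)
  have C2_inner: "C2 a \<bullet> y = y $ 1 + a * y $ 2" for y
    by (simp add: C2_def inner_vec_def sum_2)
  have X1: "(X1 i has_vector_derivative A1 a *v X1 i t
        + (v t $ i - \<gamma> * l (r t + a *\<^sub>R s t) $ i) *\<^sub>R B1) (at t within {0..})"
    and X2: "(X2 i has_vector_derivative A2 *v X2 i t
        + (\<gamma> * l ((2 * a) *\<^sub>R p t + a\<^sup>2 *\<^sub>R q t) $ i) *\<^sub>R B2) (at t within {0..})"
    if "t \<ge> 0" for i t
    using dac that unfolding dac_solution_def l_def laplacian_mult_component[OF graph weights]
    by (simp_all add: C1_inner C2_inner p_def q_def r_def s_def)
  have p': "(p has_vector_derivative - (2 * a) *\<^sub>R p t - a\<^sup>2 *\<^sub>R q t + v t - \<gamma> *\<^sub>R l (r t + a *\<^sub>R s t))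
      (at t within {0..})" if "t \<ge> 0" for t
  proof -
    have "(p has_vector_derivative (\<chi> i. (A1 a *v X1 i t
        + (v t $ i - \<gamma> * l (r t + a *\<^sub>R s t) $ i) *\<^sub>R B1) $ 1)) (at t within {0..})"
      unfolding p_def by (intro has_vector_derivative_vec_lambda has_vector_derivative_vec_nth X1 that)
    also have "(\<chi> i. (A1 a *v X1 i t + (v t $ i - \<gamma> * l (r t + a *\<^sub>R s t) $ i) *\<^sub>R B1) $ 1)
        = - (2 * a) *\<^sub>R p t - a\<^sup>2 *\<^sub>R q t + v t - \<gamma> *\<^sub>R l (r t + a *\<^sub>R s t)"
      by (simp add: vec_eq_iff A1_def B1_def matrix_vector_mult_def sum_2 p_def q_def)
    finally show ?thesis .
  qed
  have q': "(q has_vector_derivative p t) (at t within {0..})" if "t \<ge> 0" for t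
  proof -
    have "(q has_vector_derivative (\<chi> i. (A1 a *v X1 i t
        + (v t $ i - \<gamma> * l (r t + a *\<^sub>R s t) $ i) *\<^sub>R B1) $ 2)) (at t within {0..})"
      unfolding q_def by (intro has_vector_derivative_vec_lambda has_vector_derivative_vec_nth X1 that)
    also have "(\<chi> i. (A1 a *v X1 i t + (v t $ i - \<gamma> * l (r t + a *\<^sub>R s t) $ i) *\<^sub>R B1) $ 2) = p t"
      by (simp add: vec_eq_iff A1_def B1_def matrix_vector_mult_def sum_2 p_def)
    finally show ?thesis .
  qed
  have r': "(r has_vector_derivative \<gamma> *\<^sub>R l ((2 * a) *\<^sub>R p t + a\<^sup>2 *\<^sub>R q t)) (at t within {0..})"
    if "t \<ge> 0" for t
  proof -
    have "(r has_vector_derivative (\<chi> i. (A2 *v X2 i t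
        + (\<gamma> * l ((2 * a) *\<^sub>R p t + a\<^sup>2 *\<^sub>R q t) $ i) *\<^sub>R B2) $ 1)) (at t within {0..})"
      unfolding r_def by (intro has_vector_derivative_vec_lambda has_vector_derivative_vec_nth X2 that)
    also have "(\<chi> i. (A2 *v X2 i t + (\<gamma> * l ((2 * a) *\<^sub>R p t + a\<^sup>2 *\<^sub>R q t) $ i) *\<^sub>R B2) $ 1)
        = \<gamma> *\<^sub>R l ((2 * a) *\<^sub>R p t + a\<^sup>2 *\<^sub>R q t)"
      by (simp add: vec_eq_iff A2_def B2_def matrix_vector_mult_def sum_2)
    finally show ?thesis .
  qed
  have s': "(s has_vector_derivative r t) (at t within {0..})" if "t \<ge> 0" for t
  proof -
    have "(s has_vector_derivative (\<chi> i. (A2 *v X2 i t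
        + (\<gamma> * l ((2 * a) *\<^sub>R p t + a\<^sup>2 *\<^sub>R q t) $ i) *\<^sub>R B2) $ 2)) (at t within {0..})"
      unfolding s_def by (intro has_vector_derivative_vec_lambda has_vector_derivative_vec_nth X2 that)
    also have "(\<chi> i. (A2 *v X2 i t + (\<gamma> * l ((2 * a) *\<^sub>R p t + a\<^sup>2 *\<^sub>R q t) $ i) *\<^sub>R B2) $ 2) = r t"
      by (simp add: vec_eq_iff A2_def B2_def matrix_vector_mult_def sum_2 r_def)
    finally show ?thesis .
  qed
  \<comment> \<open>\<open>m t / a\<^sup>2\<close> is the rest value of \<open>q\<close> when the
    input is held at \<open>m t\<close>. After this shift only \<open>m'\<close> enters, which
    converges even if \<open>m\<close> grows like a ramp.\<close>
  define Q where "Q t = q t - vec (m t / a\<^sup>2)" for t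
  \<comment> \<open>The mean of \<open>r\<close> stays at its arbitrary initial value and that of
    \<open>s\<close> may drift linearly; passing to images under \<open>l\<close> removes both, and
    only these images feed back into \<open>p\<close>.\<close>
  define Y where "Y t = (p t, Q t, l (r t), l (s t))" for t
  define U where "U t = (x t, vec (- m' t / a\<^sup>2) :: real ^ 'n, 0 :: real ^ 'n, 0 :: real ^ 'n)" for t
  have l_vec: "l (y + vec c) = l y" for y c
    by (simp add: linear_add[OF l]) (simp add: l_def laplacian_vec[OF graph weights])
  have q_eq: "(2 * a) *\<^sub>R p t + a\<^sup>2 *\<^sub>R q t = ((2 * a) *\<^sub>R p t + a\<^sup>2 *\<^sub>R Q t) + vec (m t)" for t
    using a by (simp add: Q_def vec_eq_iff algebra_simps)
  have Y: "(Y has_vector_derivative dac_map l \<gamma> a (Y t) + U t) (at t within {0..})" if "t \<ge> 0" for t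
  proof -
    have "((\<lambda>t. vec (m t / a\<^sup>2) :: real ^ 'n) has_vector_derivative vec (m' t / a\<^sup>2)) (at t within {0..})"
      using m[OF that] by (intro bounded_linear.has_vector_derivative[OF bounded_linear_vec])
        (auto simp: has_real_derivative_iff_has_vector_derivative[symmetric] intro: DERIV_cdivide)
    then have "(Y has_vector_derivative
        (- (2 * a) *\<^sub>R p t - a\<^sup>2 *\<^sub>R q t + v t - \<gamma> *\<^sub>R l (r t + a *\<^sub>R s t),
         p t - vec (m' t / a\<^sup>2), l (\<gamma> *\<^sub>R l ((2 * a) *\<^sub>R p t + a\<^sup>2 *\<^sub>R q t)), l (r t))) (at t within {0..})"
      unfolding Y_def Q_def
      by (intro has_vector_derivative_Pair has_vector_derivative_diff p' q' that
          bounded_linear.has_vector_derivative[OF l[unfolded linear_conv_bounded_linear]] r' s')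
    also have "(- (2 * a) *\<^sub>R p t - a\<^sup>2 *\<^sub>R q t + v t - \<gamma> *\<^sub>R l (r t + a *\<^sub>R s t),
         p t - vec (m' t / a\<^sup>2), l (\<gamma> *\<^sub>R l ((2 * a) *\<^sub>R p t + a\<^sup>2 *\<^sub>R q t)), l (r t))
        = dac_map l \<gamma> a (Y t) + U t"
    proof -
      have "- (2 * a) *\<^sub>R p t - a\<^sup>2 *\<^sub>R q t + v t = - (2 * a) *\<^sub>R p t - a\<^sup>2 *\<^sub>R Q t + x t"
        using a by (simp add: Q_def vec_eq_iff v[OF that] algebra_simps)
      moreover have "p t - vec (m' t / a\<^sup>2) = p t + vec (- m' t / a\<^sup>2)"
        by (simp add: vec_eq_iff)
      ultimately show ?thesis
        unfolding q_eq l_vec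
        by (simp add: dac_map_def Y_def U_def average_l linear_add[OF l] linear_scale[OF l] algebra_simps)
    qed
    finally show ?thesis .
  qed
  have "(U \<longlongrightarrow> (x_lim, vec (- slope / a\<^sup>2), 0, 0)) at_top"
    unfolding U_def using a
    by (intro tendsto_Pair x(1) tendsto_const bounded_linear.tendsto[OF bounded_linear_vec]
        tendsto_divide tendsto_minus m') auto
  then obtain Y_lim where Y_lim: "(Y \<longlongrightarrow> Y_lim) at_top"
      "dac_map l \<gamma> a Y_lim + (x_lim, vec (- slope / a\<^sup>2), 0, 0) = 0"
    using stable_forced_converges[OF stable_map_dac[OF a \<gamma>, folded l_def] Y] by blast
  obtain P' Q' R' S' where Y_lim_eq: "Y_lim = (P', Q', R', S')"
    by (cases Y_lim) auto
  \<comment> \<open>\<open>e\<close> is the limit of the vector of tracking errors. Below,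
    \<open>l e\<close> is constant with mean 0, hence 0; the same argument then applies to
    \<open>e\<close>, whose mean vanishes by \<open>eq1\<close>.\<close>
  define e where "e = (2 * a) *\<^sub>R P' + a\<^sup>2 *\<^sub>R Q'"
  have eq1: "- e - \<gamma> *\<^sub>R (R' + a *\<^sub>R S') + x_lim = 0"
    and eq3: "\<gamma> *\<^sub>R l (l e) - vec (average R') = 0" and eq4: "R' - vec (average S') = 0"
    using Y_lim(2) by (auto simp: dac_map_def Y_lim_eq e_def zero_prod_def)
  have R': "average R' = 0"
    using arg_cong[OF eq3, of average] by (simp add: average_simps average_l)
  have S': "average S' = 0"
    using arg_cong[OF eq4, of average] R' by (simp add: average_simps)
  have "l (l e) = 0" using eq3 R' \<gamma> by simp
  then have "l e = 0"
    using laplacian_eq_0D[OF graph weights, of "l e"] by (simp add: l_def[symmetric] average_l)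
  then have "e = vec (average e)"
    using laplacian_eq_0D[OF graph weights, of e] by (simp add: l_def)
  moreover have "average e = 0"
    using arg_cong[OF eq1, of average] R' S' x(2) by (simp add: average_simps linear_neg[OF linear_average])
  ultimately have "e = 0" by simp
  have "((\<lambda>t. (2 * a) *\<^sub>R fst (Y t) + a\<^sup>2 *\<^sub>R fst (snd (Y t))) \<longlongrightarrow>
      (2 * a) *\<^sub>R fst Y_lim + a\<^sup>2 *\<^sub>R fst (snd Y_lim)) at_top"
    by (intro tendsto_intros Y_lim(1))
  then have "((\<lambda>t. (2 * a) *\<^sub>R p t + a\<^sup>2 *\<^sub>R Q t) \<longlongrightarrow> 0) at_top"
    by (simp add: Y_def Y_lim_eq e_def[symmetric] \<open>e = 0\<close>)
  from tendsto_vec_nth[OF this, of i]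
  have "((\<lambda>t. ((2 * a) *\<^sub>R p t + a\<^sup>2 *\<^sub>R Q t) $ i) \<longlongrightarrow> 0) at_top" by simp
  moreover have "((2 * a) *\<^sub>R p t + a\<^sup>2 *\<^sub>R Q t) $ i = C1 a \<bullet> X1 i t - m t" for t
    using arg_cong[OF q_eq[of t], of "\<lambda>y. y $ i"] by (simp add: C1_inner p_def q_def)
  ultimately show ?thesis by simp
qed

end

section \<open>Attacks and their detection\<close>

text \<open>A hypothesis on \<open>Lim\<close> is informative only once the limit is known to exist;
  for a ramp plus a convergent term it does in \<open>ereal\<close>, whatever the sign of the
  slope.\<close>

lemma ramp_ereal_limit:
  fixes g :: "real \<Rightarrow> real"
  assumes "(g \<longlongrightarrow> l) at_top"
  shows "\<exists>L. ((\<lambda>t. ereal (slope * t + g t)) \<longlongrightarrow> L) at_top"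
proof -
  have pos: "filterlim (\<lambda>t. s * t + h t) at_top at_top"
    if "(h \<longlongrightarrow> k) at_top" "s > 0" for h :: "real \<Rightarrow> real" and k s
    using filterlim_tendsto_add_at_top[OF that(1)
        filterlim_tendsto_pos_mult_at_top[OF tendsto_const \<open>s > 0\<close> filterlim_ident]]
    by (simp add: add.commute)
  consider "slope = 0" | "slope > 0" | "slope < 0" by linarith
  then show ?thesis
  proof cases
    case 1
    with assms have "((\<lambda>t. ereal (slope * t + g t)) \<longlongrightarrow> ereal l) at_top" by simp
    then show ?thesis by blast
  next
    case 2
    from pos[OF assms this] show ?thesis
      unfolding tendsto_PInfty_eq_at_top[symmetric] by blast
  next
    case 3
    have "filterlim (\<lambda>t. - (slope * t + g t)) at_top at_top"
      using pos[OF tendsto_minus[OF assms], of "- slope"] 3 by (simp add: algebra_simps)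
    then have "((\<lambda>t. - ereal (- (slope * t + g t))) \<longlongrightarrow> - \<infinity>) at_top"
      unfolding tendsto_PInfty_eq_at_top[symmetric] by (intro tendsto_uminus_ereal)
    then have "((\<lambda>t. ereal (slope * t + g t)) \<longlongrightarrow> - \<infinity>) at_top"
      by (simp add: add.commute)
    then show ?thesis by blast
  qed
qed

text \<open>The convergent antiderivative \<open>g\<close> provides what the limit alone does not:
  the integrated false current stays within a convergent term of a ramp.\<close>

lemma attacked_current_converges:
  assumes "hurwitz Ak" "attack_state Ta Ak Ct d \<phi>"
  obtains l g g_lim where "((\<lambda>t. k_vec \<bullet> \<phi> t) \<longlongrightarrow> l) at_top" "(g \<longlongrightarrow> g_lim) at_top"
    "\<And>t. t \<ge> Ta \<Longrightarrow> (g has_real_derivative k_vec \<bullet> \<phi> t - l) (at t within {Ta..})"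
proof -
  have "(\<phi> has_vector_derivative Ak *v \<phi> t + E_bar Ct *v d) (at t within {Ta..})" if "t \<ge> Ta" for t
    using assms(2) that by (simp add: attack_state_def)
  from stable_constant_input[OF stable_map_hurwitz[OF assms(1)] this]
  obtain \<phi>_lim g g_lim where "(\<phi> \<longlongrightarrow> \<phi>_lim) at_top" "(g \<longlongrightarrow> g_lim) at_top"
    and g: "\<And>t. t \<ge> Ta \<Longrightarrow> (g has_vector_derivative \<phi> t - \<phi>_lim) (at t within {Ta..})"
    by blast
  moreover have "((\<lambda>t. k_vec \<bullet> g t) has_real_derivative k_vec \<bullet> \<phi> t - k_vec \<bullet> \<phi>_lim) (at t within {Ta..})"
    if "t \<ge> Ta" for t
    using bounded_linear.has_vector_derivative[OF bounded_linear_inner_right g[OF that], of k_vec]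
    by (simp add: has_real_derivative_iff_has_vector_derivative inner_diff_right)
  ultimately show ?thesis
    by (intro that[of "k_vec \<bullet> \<phi>_lim" "\<lambda>t. k_vec \<bullet> g t" "k_vec \<bullet> g_lim"]) (auto intro: tendsto_intros)
qed

theorem theorem4:
  fixes E Ea :: "('n::finite \<times> 'n) set"
    and w wd :: "'n \<Rightarrow> 'n \<Rightarrow> real"
    and Vref kI \<gamma> a Ta ts T dbar :: real
    and Is Ct :: "'n \<Rightarrow> real"
    and il :: "real ^ 'n"
    and Ak :: "'n \<Rightarrow> real ^ 3 ^ 3"
    and d :: "'n \<Rightarrow> 'n \<Rightarrow> real ^ 2"
    and \<phi> :: "'n \<Rightarrow> 'n \<Rightarrow> real \<Rightarrow> real ^ 3"
    and \<psi> \<psi>_free \<psi>_att :: "real \<Rightarrow> real ^ 'n"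
    and X1 X2 :: "'n \<Rightarrow> real \<Rightarrow> real ^ 2"
    and i :: 'n
  assumes network: "connected_graph E" "edge_weights E w"
    and parameters: "kI > 0" "\<And>j. Is j > 0"
    and attack_free: "secondary_solution E w kI Is Vref il (\<lambda>_ _ _. 0) \<psi>_free"
    and balanced: "average (\<psi>_free 0) = 0"
    and attacked_links: "Ea \<subseteq> E" "Ta \<ge> 0"
    and attack_parameters: "\<And>j. hurwitz (Ak j)" "\<And>j. Ct j > 0"
      "\<And>j k. (j, k) \<in> Ea \<Longrightarrow> E_bar (Ct k) *v d j k \<noteq> 0"
    and attack: "\<And>j k. (j, k) \<in> Ea \<Longrightarrow> attack_state Ta (Ak k) (Ct k) (d j k) (\<phi> j k)"
    and attacked: "secondary_solution E w kI Is Vref il (falsification Ea Ta \<phi>) \<psi>"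
    and same_initial: "\<psi> 0 = \<psi>_free 0"
    and decomposition: "\<And>t. \<psi>_att t = \<psi> t - \<psi>_free t"
    and dac_parameters: "edge_weights E wd" "\<gamma> > 0" "a > 0"
    and dac: "dac_solution E wd \<gamma> a (\<lambda>t. voltages Vref (\<psi> t)) X1 X2"
    and detection: "ts > 0" "T > 0" "dbar \<ge> 0"
    and large_attack:
      "Lim at_top (\<lambda>t. ereal (average (\<psi>_att t))) > ereal (1 / T * dbar)"
  shows "\<not> (\<forall>t\<ge>ts. detection_indicator ts T (\<lambda>\<tau>. Vref - C1 a \<bullet> X1 i \<tau>) t \<le> dbar)"
proof -
  define \<delta> where "\<delta> = falsification Ea Ta \<phi>"
  have "\<exists>l g g_lim. (\<delta> j k \<longlongrightarrow> l) at_top \<and> (g \<longlongrightarrow> g_lim) at_top \<and>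
      (\<forall>t\<ge>Ta. (g has_real_derivative \<delta> j k t - l) (at t within {Ta..}))" for j k
  proof (cases "(j, k) \<in> Ea")
    case True
    obtain l g g_lim where lg: "((\<lambda>t. k_vec \<bullet> \<phi> j k t) \<longlongrightarrow> l) at_top" "(g \<longlongrightarrow> g_lim) at_top"
      "\<And>t. t \<ge> Ta \<Longrightarrow> (g has_real_derivative k_vec \<bullet> \<phi> j k t - l) (at t within {Ta..})"
      using attacked_current_converges[OF attack_parameters(1) attack[OF True]] by blast
    have \<delta>: "k_vec \<bullet> \<phi> j k t = \<delta> j k t" if "t \<ge> Ta" for t
      using True that by (simp add: \<delta>_def falsification_def)
    have "(\<delta> j k \<longlongrightarrow> l) at_top"
      by (rule Lim_transform_eventually[OF lg(1) eventually_at_top_linorderI[OF \<delta>]])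
    with lg(2,3) \<delta> show ?thesis by (metis (no_types, lifting))
  next
    case False
    then have "\<delta> j k = (\<lambda>_. 0)" by (simp add: \<delta>_def falsification_def fun_eq_iff)
    then show ?thesis
      by (intro exI[of _ 0] exI[of _ "\<lambda>_. 0"] conjI allI impI) auto
  qed
  then obtain \<delta>_lim g g_lim where \<delta>_lim: "\<And>j k. (\<delta> j k \<longlongrightarrow> \<delta>_lim j k) at_top"
    and g_lim: "\<And>j k. (g j k \<longlongrightarrow> g_lim j k) at_top"
    and g: "\<And>j k t. t \<ge> Ta \<Longrightarrow> (g j k has_real_derivative \<delta> j k t - \<delta>_lim j k) (at t within {Ta..})"
    by metis
  \<comment> \<open>\<open>S\<close> maps the false data to the derivative of the mean of
    \<open>\<psi>\<close>. Being linear, it carries the limits and antiderivatives of single links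
    over to the mean.\<close>
  define S where "S y = kI * average (\<chi> i. \<Sum>j\<in>E `` {i}. w i j * y i j / Is j)"
    for y :: "'n \<Rightarrow> 'n \<Rightarrow> real"
  have S_diff: "S (\<lambda>i j. y i j - y' i j) = S y - S y'" for y y'
    by (simp add: S_def average_def sum_subtractf right_diff_distrib diff_divide_distrib)
  have S_tendsto: "((\<lambda>t. S (\<lambda>i j. y i j t)) \<longlongrightarrow> S l) at_top" if "\<And>i j. (y i j \<longlongrightarrow> l i j) at_top" for y l
    unfolding S_def average_def vec_lambda_beta using parameters(2)
    by (intro tendsto_intros that) (auto simp: less_le)
  define m where "m t = average (\<psi> t)" for t
  have m: "(m has_real_derivative S (\<lambda>i j. \<delta> i j t)) (at t within {0..})" if "t \<ge> 0" for t
    using secondary_average_derivative[OF network attacked that] by (simp add: m_def[abs_def] S_def \<delta>_def)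
  define slope where "slope = S \<delta>_lim"
  define G where "G t = S (\<lambda>i j. g i j t)" for t
  have G_lim: "(G \<longlongrightarrow> S g_lim) at_top"
    unfolding G_def by (rule S_tendsto[OF g_lim])
  have G: "(G has_real_derivative S (\<lambda>i j. \<delta> i j t) - slope) (at t within {Ta..})" if "t \<ge> Ta" for t
    unfolding G_def slope_def S_diff[symmetric] unfolding S_def average_def vec_lambda_beta
    by (intro DERIV_cmult DERIV_cdivide DERIV_sum g that)
  \<comment> \<open>\<open>G\<close> integrates the deviation of the input from
    \<open>slope\<close>, so what remains of the mean from \<open>Ta\<close> on is constant.\<close>
  have "((\<lambda>t. m t - slope * t - G t) has_vector_derivative 0) (at t within {Ta..})" if "t \<ge> Ta" for t
  proof -
    have "(m has_real_derivative S (\<lambda>i j. \<delta> i j t)) (at t within {Ta..})"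
      using m[of t] attacked_links(2) that by (auto intro: has_field_derivative_subset)
    then show ?thesis
      unfolding has_real_derivative_iff_has_vector_derivative[symmetric]
      by (auto intro!: derivative_eq_intros G that)
  qed
  then obtain c where "\<And>t. t \<in> {Ta..} \<Longrightarrow> m t - slope * t - G t = c"
    using has_vector_derivative_zero_constant[of "{Ta..}" "\<lambda>t. m t - slope * t - G t"] by auto
  then have m_eq: "m t = slope * t + (G t + c)" if "t \<ge> Ta" for t
    using that by (force simp: algebra_simps)
  \<comment> \<open>Without attack the mean keeps its initial value 0, so \<open>m\<close> is
    exactly the mean of \<open>\<psi>_att\<close>.\<close>
  have free: "average (\<psi>_free t) = 0" if "t \<ge> 0" for t
  proof -
    have "((\<lambda>t. average (\<psi>_free t)) has_vector_derivative 0) (at s within {0..})" if "s \<in> {0..}" for s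
      using secondary_average_derivative[OF network attack_free, of s] that
      by (simp add: has_real_derivative_iff_has_vector_derivative zero_vec_def[symmetric] average_simps)
    then obtain c where "\<And>t. t \<in> {0..} \<Longrightarrow> average (\<psi>_free t) = c"
      using has_vector_derivative_zero_constant[of "{0..}" "\<lambda>t. average (\<psi>_free t)"] by auto
    from this[of t] this[of 0] balanced that show ?thesis by simp
  qed
  obtain L where "((\<lambda>t. ereal (slope * t + (G t + c))) \<longlongrightarrow> L) at_top"
    using ramp_ereal_limit[OF tendsto_add[OF G_lim tendsto_const]] by blast
  moreover have "eventually (\<lambda>t. ereal (slope * t + (G t + c)) = ereal (average (\<psi>_att t))) at_top"
    using attacked_links(2)
    by (intro eventually_at_top_linorderI[of Ta])
      (simp add: m_eq[symmetric] m_def decomposition average_simps free)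
  ultimately have att: "((\<lambda>t. ereal (average (\<psi>_att t))) \<longlongrightarrow> L) at_top"
    by (rule Lim_transform_eventually)
  then have "L > ereal (1 / T * dbar)"
    using large_attack tendsto_Lim[OF trivial_limit_at_top_linorder att] by simp
  \<comment> \<open>\<open>L\<close> may be infinite, hence the real level \<open>b\<close> below
    it. The gap between \<open>b\<close> and the lower level \<open>b'\<close> absorbs the vanishing
    estimation error.\<close>
  then obtain b where b: "1 / T * dbar < b" "ereal b < L"
    using ereal_dense2 by (metis less_ereal.simps(1))
  then obtain b' where b': "1 / T * dbar < b'" "b' < b" using dense by blast
  obtain x where x: "((\<lambda>t. \<psi> t - vec (average (\<psi> t))) \<longlongrightarrow> x) at_top"
    using secondary_deviation_converges[OF network parameters attacked[folded \<delta>_def] \<delta>_lim] by blast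
  have "((\<lambda>t. average (\<psi> t - vec (average (\<psi> t)))) \<longlongrightarrow> average x) at_top"
    by (rule bounded_linear.tendsto[OF bounded_linear_average x])
  then have "average x = 0"
    by (simp add: average_simps tendsto_const_iff)
  have "((\<lambda>t. C1 a \<bullet> X1 i t - (Vref + m t)) \<longlongrightarrow> 0) at_top"
  proof (rule dac_tracks_average[OF network(1) dac_parameters(1,3,2) dac _ _ S_tendsto[OF \<delta>_lim] x
        \<open>average x = 0\<close>])
    show "voltages Vref (\<psi> t) = vec (Vref + m t) + (\<psi> t - vec (average (\<psi> t)))" for t
      by (simp add: voltages_def m_def vec_eq_iff)
    show "((\<lambda>t. Vref + m t) has_real_derivative S (\<lambda>i j. \<delta> i j t)) (at t within {0..})" if "t \<ge> 0" for t
      by (auto intro!: derivative_eq_intros m that)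
  qed
  then have "eventually (\<lambda>t. C1 a \<bullet> X1 i t - (Vref + m t) > b' - b) at_top"
    using b'(2) by (intro order_tendstoD) auto
  moreover have "eventually (\<lambda>t. average (\<psi>_att t) > b) at_top"
    using order_tendstoD(1)[OF att b(2)] by simp
  ultimately have "eventually (\<lambda>t. \<bar>Vref - C1 a \<bullet> X1 i t\<bar> \<ge> b') at_top"
    using eventually_ge_at_top[of 0]
    by eventually_elim (auto simp: m_def decomposition average_simps free)
  then obtain t1 where t1: "\<And>t. t \<ge> t1 \<Longrightarrow> \<bar>Vref - C1 a \<bullet> X1 i t\<bar> \<ge> b'"
    by (auto simp: eventually_at_top_linorder)
  \<comment> \<open>The window from \<open>t - T\<close> to \<open>t\<close> starts after
    \<open>ts\<close>, so the indicator is past its initial zero phase; after \<open>0\<close>,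
    where the estimator states are continuous; and after \<open>t1\<close>, where the error bound
    holds.\<close>
  define t where "t = max ts (max 0 t1) + T"
  have "continuous_on {0..} (X1 i)"
    using dac unfolding dac_solution_def continuous_on_eq_continuous_within
    by (auto intro: has_vector_derivative_continuous)
  then have "continuous_on {t - T..t} (X1 i)"
    by (rule continuous_on_subset) (auto simp: t_def)
  then have "(\<lambda>\<tau>. \<bar>Vref - C1 a \<bullet> X1 i \<tau>\<bar>) integrable_on {t - T..t}"
    by (intro integrable_continuous_real continuous_intros)
  then have "integral {t - T..t} (\<lambda>\<tau>. b') \<le> integral {t - T..t} (\<lambda>\<tau>. \<bar>Vref - C1 a \<bullet> X1 i \<tau>\<bar>)"
    by (intro integral_le integrable_const_ivl t1) (auto simp: t_def)
  moreover have "dbar < integral {t - T..t} (\<lambda>\<tau>. b')"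
    using b'(1) detection(2) by (simp add: field_simps)
  moreover have "t \<ge> ts + T" by (simp add: t_def)
  ultimately have "detection_indicator ts T (\<lambda>\<tau>. Vref - C1 a \<bullet> X1 i \<tau>) t > dbar"
    by (simp add: detection_indicator_def)
  moreover have "t \<ge> ts" using \<open>t \<ge> ts + T\<close> detection(2) by simp
  ultimately show ?thesis by (meson not_le)
qed

end
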